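(* Let $n\ge2$, $\frac{n-1}{2}<s<n-1$, and let $X\subset\partial_\infty\mathbb{H}^n$ be a truly $s$-dimensional set, with identification centered at $o\in\mathbb{H}^n$ and constant $K$ as in condition (iv). Then there is a bounded function $u\in C^\infty(\mathbb{H}^n)$ with $-\Delta u=\frac{(n-1)^2}{4}u$ on $\mathbb{H}^n$ and an open set $\Omega\subset\mathbb{H}^n$ on which $u>0$ (and $u=0$ on $\partial\Omega$) such that $\partial_\infty\Omega=\overline X$. Moreover, for every $p\in\Omega$, $$|u(p)|\le M_0\,(d+1)\,e^{-\left(s-\frac{n-1}{2}\right)d},\qquad d=d(p,o),$$ where $M_0>0$ depends only on $K$, $n$ and $s$.
   Context: $\mathbb{H}^n$ is hyperbolic space, $\Delta$ its Laplace–Beltrami operator, $\partial_\infty\mathbb{H}^n$ its ideal boundary (classes of geodesic rays at bounded distance) with the cone topology, and $\partial_\infty\Omega$ the boundary of $\Omega$ in $\mathbb{H}^n\cup\partial_\infty\mathbb{H}^n$ minus its boundary in $\mathbb{H}^n$. Choosing a point $o$ and a Poincaré ball model $B=\{x\in\mathbb{R}^n:|x|<1\}$ (metric $\frac{4}{(1-|x|^2)^2}\delta_{ij}$) with $o$ at the origin identifies $\partial_\infty\mathbb{H}^n$ with the unit sphere $\partial B$. A set $X\subset\partial_\infty\mathbb{H}^n$ is truly $s$-dimensional if, for some such identification, its image $\Lambda\subset\partial B$ satisfies: (i) Hausdorff dimension $s$; (ii) $H^s(\Lambda)<\infty$; (iii) $\liminf_{r\to0}H^s(\Lambda\cap B_r(p_0))/r^s>0$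 for every $p_0\in\Lambda$; (iv) there is $K>0$ with $H^s(\Lambda\cap B_r(p_0))\le Kr^s$ for all $p_0\in\Lambda$, $r>0$; here $H^s$ is Euclidean Hausdorff measure and $B_r(p_0)$ the Euclidean ball in $\mathbb{R}^n$. *)

theory Defs
  imports "HOL-Analysis.Analysis"
begin

definition partial_deriv :: "'n::finite \<Rightarrow> (real^'n \<Rightarrow> real) \<Rightarrow> real^'n \<Rightarrow> real" where
  "partial_deriv i f x = frechet_derivative f (at x) (axis i 1)"

fun iter_partial :: "'n::finite list \<Rightarrow> (real^'n \<Rightarrow> real) \<Rightarrow> real^'n \<Rightarrow> real" where
  "iter_partial [] f = f"
| "iter_partial (i # is) f = partial_deriv i (iter_partial is f)"

text \<open>C-infinity on an open set: all iterated partial derivatives exist and are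
(Frechet) differentiable, hence continuous, on S.\<close>
definition smooth_on :: "(real^'n::finite) set \<Rightarrow> (real^'n \<Rightarrow> real) \<Rightarrow> bool" where
  "smooth_on S f \<longleftrightarrow> (\<forall>is. iter_partial is f differentiable_on S)"

definition euclid_laplacian :: "(real^'n::finite \<Rightarrow> real) \<Rightarrow> real^'n \<Rightarrow> real" where
  "euclid_laplacian f x = (\<Sum>i\<in>UNIV. partial_deriv i (partial_deriv i f) x)"

text \<open>Laplace--Beltrami operator of the Poincare ball metric 4/(1-|x|^2)^2 delta_ij,
  n = CARD('n): Delta u = ((1-|x|^2)^2/4) (Delta_E u + 2(n-2)/(1-|x|^2) x . grad u).\<close>
definition hyp_laplacian :: "(real^'n::finite \<Rightarrow> real) \<Rightarrow> real^'n \<Rightarrow> real" where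
  "hyp_laplacian f x =
     ((1 - (norm x)\<^sup>2)\<^sup>2 / 4) *
     (euclid_laplacian f x
      + 2 * (real CARD('n) - 2) / (1 - (norm x)\<^sup>2) * (\<Sum>i\<in>UNIV. x $ i * partial_deriv i f x))"

definition hyp_dist :: "real^'n::finite \<Rightarrow> real^'n \<Rightarrow> real" where
  "hyp_dist x y = arcosh (1 + 2 * (norm (x - y))\<^sup>2 / ((1 - (norm x)\<^sup>2) * (1 - (norm y)\<^sup>2)))"

definition hs_term :: "real \<Rightarrow> 'a::metric_space set \<Rightarrow> ennreal" where
  "hs_term s U = (if U = {} then 0 else if s = 0 then 1 else ennreal (diameter U powr s))"

definition hausdorff_pre :: "real \<Rightarrow> real \<Rightarrow> 'a::metric_space set \<Rightarrow> ennreal" where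
  "hausdorff_pre s \<delta> A =
     (INF C \<in> {C :: nat \<Rightarrow> 'a set. A \<subseteq> (\<Union>i. C i) \<and> (\<forall>i. bounded (C i) \<and> diameter (C i) \<le> \<delta>)}.
        (\<Sum>i. hs_term s (C i)))"

text \<open>(Unnormalised) s-dimensional Hausdorff measure.\<close>
definition hausdorff_measure :: "real \<Rightarrow> 'a::metric_space set \<Rightarrow> ennreal" where
  "hausdorff_measure s A = (SUP \<delta> \<in> {0<..}. hausdorff_pre s \<delta> A)"

definition hausdorff_dim :: "'a::metric_space set \<Rightarrow> real" where
  "hausdorff_dim A = Inf {s. 0 \<le> s \<and> hausdorff_measure s A = 0}"

definition truly_dim :: "real \<Rightarrow> real \<Rightarrow> (real^'n::finite) set \<Rightarrow> bool" where
  "truly_dim s K \<Lambda> \<longleftrightarrow>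
     \<Lambda> \<subseteq> sphere 0 1 \<and>
     hausdorff_dim \<Lambda> = s \<and>
     hausdorff_measure s \<Lambda> < \<infinity> \<and>
     (\<forall>p0\<in>\<Lambda>. Liminf (at_right 0) (\<lambda>r. hausdorff_measure s (\<Lambda> \<inter> ball p0 r) / ennreal (r powr s)) > 0) \<and>
     K > 0 \<and>
     (\<forall>p0\<in>\<Lambda>. \<forall>r>0. hausdorff_measure s (\<Lambda> \<inter> ball p0 r) \<le> ennreal (K * r powr s))"

end

theory Submission
  imports Defs
begin

text \<open>
With $h = (n-1)/2$ and the Poisson kernel $P(x,\xi) = (1-|x|^2)/|x-\xi|^2$, every function
$\Phi(\ln P)$ satisfies $\Delta\Phi(\ln P) = \Phi'' - 2h\Phi'$, so both $P^h$ and $P^h \ln P$ are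
eigenfunctions for $-h^2$ (the exponent $h$ is a double root).  Integrating the second one against
$H^s$ restricted to $\Lambda$ gives $u(x) = \int P^h \ln P \, dH^s$, and $\Omega = \{u > 0\}$.
Since $|\ln P| \le d(x,0)$ and, summing over dyadic shells around $x$, $\int P^b \, dH^s \le C (1-|x|)^{s-b}$
whenever $2b > s$, the case $b = h$ gives the decay.  Near boundary points off $\overline\Lambda$ one
has $P < 1$ on the whole support, so $u \le 0$ there.  At $x = (1-r)p$ with $p \in \Lambda$ the points
within $r$ of $p$ contribute at least a multiple of $r^{s-h}$, whereas the negative part of $P^h \ln P$
is at most a multiple of $P^b$ for any $s/2 < b < h$ and contributes only $O(r^{s-b})$; hence $u > 0$.
\<close>

section \<open>Metric outer measures and Hausdorff measure\<close>

text \<open>\<open>P^h\<close> alone is positive everywhere, so it has no nodal set. The logarithm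
  changes sign on the horosphere \<open>P = 1\<close>, which leaves room for a domain \<Omega> that
  reaches infinity only along \<Lambda>.

  \<Lambda> is not assumed to be Borel. Integration therefore starts from the outer measure sending
  \<open>A\<close> to \<open>H^s\<close> of \<open>\<Lambda> \<inter> A\<close>, which is a metric
  outer measure for any \<Lambda> and so a measure on Borel sets.

  Condition (iv) controls balls centred on \<Lambda>, whereas the shells are centred at interior
  points. A ball that meets \<Lambda> lies in a ball of twice the radius centred on \<Lambda>; this
  costs a factor \<open>2^s\<close> and keeps the constants dependent on \<open>K\<close>,
  \<open>n\<close> and \<open>s\<close> alone. Condition (iii) is pointwise, without uniformity in
  \<open>p\<close>; this is enough because only membership in the closed set
  \<open>closure \<Omega>\<close> is wanted.

  The range of \<open>s\<close> enters as \<open>h < s\<close>, which makes the decay exponent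
  positive, and \<open>s < 2h\<close>, which makes the shell sums converge and leaves room for
  \<open>b\<close>.\<close>

definition separated :: "'a::metric_space set \<Rightarrow> 'a set \<Rightarrow> bool" where
  "separated A B \<longleftrightarrow> (\<exists>d>0. \<forall>a\<in>A. \<forall>b\<in>B. d \<le> dist a b)"

lemma separated_finite_Union:
  assumes "finite I" "\<And>i. i \<in> I \<Longrightarrow> separated (S i) B"
  shows "separated (\<Union>i\<in>I. S i) B"
  using assms
proof (induction I rule: finite_induct)
  case empty
  then show ?case by (auto simp: separated_def intro!: exI[of _ 1])
next
  case (insert i I)
  from insert(3)[OF insert(4)] obtain d where d: "d>0" "\<forall>a\<in>(\<Union>i\<in>I. S i). \<forall>b\<in>B. d \<le> dist a b"
    unfolding separated_def by auto
  from insert(4)[of i] obtain e where e: "e>0" "\<forall>a\<in>S i. \<forall>b\<in>B. e \<le> dist a b"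
    unfolding separated_def by auto
  show ?case unfolding separated_def
    using d e by (intro exI[of _ "min d e"]) force
qed

text \<open>\<open>infdist\<close> to \<open>F\<close> is 1-Lipschitz, so a gap between its values
  on two sets is a gap between the sets themselves.\<close>

lemma separated_infdist:
  assumes "\<And>a. a \<in> A \<Longrightarrow> s \<le> infdist a F" "\<And>b. b \<in> B \<Longrightarrow> infdist b F \<le> t" "t < s"
  shows "separated A B"
  unfolding separated_def
proof (intro exI[of _ "s - t"] conjI ballI)
  fix a b assume "a \<in> A" "b \<in> B"
  then show "s - t \<le> dist a b"
    using assms(1)[of a] assms(2)[of b] infdist_triangle[of a F b] by linarith
qed (use assms in auto)

text \<open>Bundling the axioms lets them be checked once for Hausdorff measure and then transferred
  to its restrictions to arbitrary sets.\<close>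

locale metric_outer_measure =
  fixes f :: "'a::metric_space set \<Rightarrow> ennreal"
  assumes empty: "f {} = 0"
    and mono: "A \<subseteq> B \<Longrightarrow> f A \<le> f B"
    and UN_le: "\<And>S :: nat \<Rightarrow> 'a set. f (\<Union>i. S i) \<le> (\<Sum>i. f (S i))"
    and add_separated_le: "separated A B \<Longrightarrow> f A + f B \<le> f (A \<union> B)"
begin

lemma Un_le: "f (A \<union> B) \<le> f A + f B"
proof -
  have "f (A \<union> B) = f (\<Union>i. (\<lambda>i::nat. if i = 0 then A else if i = 1 then B else {}) i)"
    by (rule arg_cong[where f=f]) (auto split: if_splits intro: exI[of _ 0] exI[of _ "Suc 0"])
  also have "\<dots> \<le> (\<Sum>i::nat. f (if i = 0 then A else if i = 1 then B else {}))"
    by (rule UN_le)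
  also have "\<dots> = (\<Sum>i\<in>{0,1::nat}. f (if i = 0 then A else if i = 1 then B else {}))"
    by (rule suminf_finite) (auto simp: empty)
  finally show ?thesis by simp
qed

lemma suminf_separated_le:
  fixes S :: "nat \<Rightarrow> 'a set"
  assumes "\<And>i j. i < j \<Longrightarrow> separated (S i) (S j)" and "\<And>i. S i \<subseteq> A"
  shows "(\<Sum>i. f (S i)) \<le> f A"
proof -
  have "(\<Sum>i<N. f (S i)) \<le> f (\<Union>i<N. S i)" for N
  proof (induction N)
    case (Suc N)
    have "separated (\<Union>i<N. S i) (S N)"
      using assms(1) by (intro separated_finite_Union) auto
    from add_separated_le[OF this] have "f (\<Union>i<N. S i) + f (S N) \<le> f (\<Union>i<Suc N. S i)"
      by (simp add: lessThan_Suc Un_commute)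
    then show ?case
      using order_trans[OF add_right_mono[OF Suc.IH]] by simp
  qed simp
  also have "f (\<Union>i<N. S i) \<le> f A" for N
    using assms(2) by (intro mono) auto
  finally have "(\<Sum>i<N. f (S i)) + 0 \<le> f A" for N by simp
  from ennreal_suminf_bound_add[OF this] show ?thesis by simp
qed

text \<open>The part \<open>D N\<close> of \<open>A\<close> at distance at least
  \<open>1/(N+1)\<close> from \<open>F\<close> is separated from \<open>A \<inter> F\<close>, so
  these two add up to at most \<open>f A\<close>. What \<open>D N\<close> misses of
  \<open>A - F\<close> lies in the shells \<open>R k\<close> with \<open>k \<ge> N\<close>, whose
  total is the tail of a convergent series.\<close>

lemma closed_caratheodory:
  assumes "closed F"
  shows "f (A \<inter> F) + f (A - F) = f A"
proof (rule antisym)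
  show "f (A \<inter> F) + f (A - F) \<le> f A"
  proof (cases "F = {} \<or> f A = \<infinity>")
    case True
    then show ?thesis by (auto simp: empty)
  next
    case False
    then have F: "F \<noteq> {}" and fin: "f A < \<infinity>" by (auto simp: top.not_eq_extremum)
    define D where "D k = {x\<in>A. 1 / (real k + 1) \<le> infdist x F}" for k :: nat
    define R where "R k = {x\<in>A. 1 / (real k + 2) \<le> infdist x F \<and> infdist x F \<le> 1 / (real k + 1)}" for k :: nat
    have sepR: "separated (R i) (R j)" if "i + 2 \<le> j" for i j
    proof (rule separated_infdist[of _ "1 / (real i + 2)" F _ "1 / (real j + 1)"])
      show "1 / (real j + 1) < 1 / (real i + 2)"
        using that by (intro divide_strict_left_mono) auto
    qed (auto simp: R_def)
    \<comment> \<open>Adjacent shells need not be separated, so the even and the odd ones are summed apart.\<close>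
    have even: "(\<Sum>i. f (R (2*i))) \<le> f A" and odd: "(\<Sum>i. f (R (2*i+1))) \<le> f A"
      by (rule suminf_separated_le; (intro sepR)?; auto simp: R_def)+
    have "(\<Sum>k<N. f (R k)) + 0 \<le> f A + f A" for N
    proof -
      have "(\<Sum>k<2*N. f (R k)) = (\<Sum>k<N. f (R (2*k))) + (\<Sum>k<N. f (R (2*k+1)))"
        by (induction N) (auto simp: algebra_simps)
      also have "\<dots> \<le> (\<Sum>i. f (R (2*i))) + (\<Sum>i. f (R (2*i+1)))"
        by (intro add_mono sum_le_suminf) auto
      also have "\<dots> \<le> f A + f A" using even odd by (rule add_mono)
      finally have "(\<Sum>k<2*N. f (R k)) \<le> f A + f A" .
      moreover have "(\<Sum>k<N. f (R k)) \<le> (\<Sum>k<2*N. f (R k))"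
        by (rule sum_mono2) auto
      ultimately show ?thesis by simp
    qed
    from ennreal_suminf_bound_add[OF this] have Rle: "(\<Sum>k. f (R k)) \<le> f A + f A" by simp
    have Rfin: "(\<Sum>k. f (R k)) < \<infinity>"
      using le_less_trans[OF Rle] fin by simp
    have cover: "A - F \<subseteq> D N \<union> (\<Union>k. R (k + N))" for N
    proof
      fix x assume x: "x \<in> A - F"
      then have pos: "infdist x F > 0"
        using in_closed_iff_infdist_zero[OF assms F] infdist_nonneg[of x F] by fastforce
      show "x \<in> D N \<union> (\<Union>k. R (k + N))"
      proof (cases "x \<in> D N")
        case False
        define P where "P m \<longleftrightarrow> 1 / (real m + 1) \<le> infdist x F" for m
        obtain m where "inverse (real (Suc m)) < infdist x F"
          using reals_Archimedean[OF pos] by auto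
        then have "P m" by (simp add: P_def inverse_eq_divide add.commute)
        \<comment> \<open>\<open>l\<close> is the first level whose threshold \<open>x\<close>
          reaches. It exceeds \<open>N\<close> because \<open>x\<close> is outside
          \<open>D N\<close>, so \<open>l - 1\<close> is the index of a shell in the tail.\<close>
        define l where "l = (LEAST m. P m)"
        have Pl: "P l" unfolding l_def by (rule LeastI[of P, OF \<open>P m\<close>])
        have "\<not> P k" if "k \<le> N" for k
        proof
          assume "P k"
          have "1 / (real N + 1) \<le> 1 / (real k + 1)"
            using that by (intro divide_left_mono) auto
          with \<open>P k\<close> False x show False by (auto simp: D_def P_def)
        qed
        with Pl have "N < l" by (meson not_less)
        then obtain j where j: "l = Suc (j + N)"
          by (metis add.commute less_imp_Suc_add add_Suc_right)
        have "\<not> P (j + N)"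
          using not_less_Least[of "j+N" P] j unfolding l_def by simp
        then have "x \<in> R (j + N)"
          using x Pl by (auto simp: P_def R_def j add_ac)
        then show ?thesis by auto
      qed simp
    qed
    \<comment> \<open>The initial shells are added on both sides, so that the tail completes to the
      full sum. That sum is finite and cancels at the end, which avoids subtraction in
      \<open>ennreal\<close>.\<close>
    have "(\<Sum>k<N. f (R k)) + (f (A \<inter> F) + f (A - F)) \<le> f A + (\<Sum>k. f (R k))" for N
    proof -
      have "f (A - F) \<le> f (D N) + f (\<Union>k. R (k + N))"
        using mono[OF cover] Un_le by (rule order_trans)
      also have "\<dots> \<le> f (D N) + (\<Sum>k. f (R (k + N)))"
        by (intro add_left_mono UN_le)
      finally have 1: "f (A - F) \<le> f (D N) + (\<Sum>k. f (R (k + N)))" .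
      have "separated (D N) (A \<inter> F)"
        by (rule separated_infdist[of _ "1 / (real N + 1)" F _ 0]) (auto simp: D_def)
      from add_separated_le[OF this] have "f (D N) + f (A \<inter> F) \<le> f (D N \<union> (A \<inter> F))" .
      also have "\<dots> \<le> f A" by (rule mono) (auto simp: D_def)
      finally have 2: "f (D N) + f (A \<inter> F) \<le> f A" .
      have "(\<Sum>k<N. f (R k)) + (f (A \<inter> F) + f (A - F))
        \<le> (\<Sum>k<N. f (R k)) + (f (A \<inter> F) + (f (D N) + (\<Sum>k. f (R (k + N)))))"
        by (intro add_left_mono 1)
      also have "\<dots> = (f (D N) + f (A \<inter> F)) + ((\<Sum>k. f (R (k + N))) + (\<Sum>k<N. f (R k)))"
        by (simp add: ac_simps)
      also have "(\<Sum>k. f (R (k + N))) + (\<Sum>k<N. f (R k)) = (\<Sum>k. f (R k))"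
        by (rule suminf_offset[symmetric]) simp
      finally show ?thesis using 2 by (meson add_right_mono order_trans)
    qed
    from ennreal_suminf_bound_add[OF this]
    have "(\<Sum>k. f (R k)) + (f (A \<inter> F) + f (A - F)) \<le> (\<Sum>k. f (R k)) + f A"
      by (simp add: add.commute)
    then show ?thesis
      using Rfin by (auto simp: ennreal_add_left_cancel_le)
  qed
next
  have "A = (A \<inter> F) \<union> (A - F)" by auto
  then show "f A \<le> f (A \<inter> F) + f (A - F)" using Un_le by metis
qed

text \<open>\<open>f\<close> is a measure on the sigma-algebra of its Caratheodory-measurable sets;
  this contains the closed sets, which generate the Borel sets.\<close>

lemma measure_space_borel: "measure_space UNIV (sets borel) f"
proof -
  interpret P: sigma_algebra UNIV "Pow UNIV :: 'a set set" by (rule sigma_algebra_Pow)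
  let ?L = "lambda_system UNIV (Pow UNIV) f"
  have "outer_measure_space (Pow UNIV) f"
    unfolding outer_measure_space_def positive_def increasing_def countably_subadditive_def
    using empty mono UN_le by auto
  then have L: "measure_space UNIV ?L f" by (rule P.caratheodory_lemma)
  then have sa: "sigma_algebra UNIV ?L" by (simp add: measure_space_def)
  have "Collect closed \<subseteq> ?L"
    unfolding P.lambda_system_eq using closed_caratheodory by auto
  then have "sigma_sets UNIV (Collect closed) \<subseteq> ?L"
    by (rule sigma_algebra.sigma_sets_subset[OF sa])
  then have "sets borel \<subseteq> ?L"
    by (simp add: borel_eq_closed)
  then show ?thesis
    using measure_down[OF L] sets.sigma_algebra_axioms[of "borel :: 'a measure"] by simp
qed

end

section \<open>Hausdorff measure as a metric outer measure\<close>

lemma hausdorff_pre_le: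
  assumes "A \<subseteq> (\<Union>i. C i)" "\<And>i::nat. bounded (C i)" "\<And>i. diameter (C i) \<le> \<delta>"
  shows "hausdorff_pre s \<delta> A \<le> (\<Sum>i. hs_term s (C i))"
  unfolding hausdorff_pre_def using assms by (intro INF_lower) auto

lemma hausdorff_pre_close:
  assumes "hausdorff_pre s \<delta> A < e"
  obtains C :: "nat \<Rightarrow> 'a::metric_space set" where "A \<subseteq> (\<Union>i. C i)" "\<And>i. bounded (C i)" "\<And>i. diameter (C i) \<le> \<delta>"
    "(\<Sum>i. hs_term s (C i)) < e"
  using assms unfolding hausdorff_pre_def INF_less_iff by blast

lemma hausdorff_pre_mono: "A \<subseteq> B \<Longrightarrow> hausdorff_pre s \<delta> A \<le> hausdorff_pre s \<delta> B"
  unfolding hausdorff_pre_def by (intro INF_superset_mono) auto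

lemma hausdorff_pre_antimono: "\<delta> \<le> \<delta>' \<Longrightarrow> hausdorff_pre s \<delta>' A \<le> hausdorff_pre s \<delta> A"
  unfolding hausdorff_pre_def by (intro INF_superset_mono) (auto intro: order_trans)

lemma hausdorff_pre_empty: "\<delta> > 0 \<Longrightarrow> hausdorff_pre s \<delta> {} = 0"
  using hausdorff_pre_le[of "{}" "\<lambda>_. {}" \<delta> s] by (simp add: hs_term_def)

text \<open>Near-optimal covers of the pieces, with excess \<open>e / 2^(n+1)\<close> for the n-th
  one, are enumerated through \<open>prod_decode\<close> into one cover of the union.\<close>

lemma hausdorff_pre_UN:
  fixes A :: "nat \<Rightarrow> 'a::metric_space set"
  shows "hausdorff_pre s \<delta> (\<Union>i. A i) \<le> (\<Sum>i. hausdorff_pre s \<delta> (A i))"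
proof (rule ennreal_le_epsilon)
  let ?O = "hausdorff_pre s \<delta>"
  fix e :: real assume "0 < e" "(\<Sum>n. ?O (A n)) < top"
  then have *: "\<And>n. ?O (A n) < ?O (A n) + e * (1/2)^Suc n"
    by (auto simp add: less_top dest!: ennreal_suminf_lessD)
  have "\<exists>C. A n \<subseteq> (\<Union>i. C i) \<and> (\<forall>i. bounded (C i) \<and> diameter (C i) \<le> \<delta>) \<and>
      (\<Sum>i. hs_term s (C i)) \<le> ?O (A n) + e * (1/2)^Suc n" for n
    by (rule hausdorff_pre_close[OF *[of n]]) (metis less_imp_le)
  then obtain B where B: "\<And>n. A n \<subseteq> (\<Union>i. B n i)" "\<And>n i. bounded (B n i)" "\<And>n i. diameter (B n i) \<le> \<delta>"
    and Ble: "\<And>n. (\<Sum>i. hs_term s (B n i)) \<le> ?O (A n) + e * (1/2)^(Suc n)"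
    by metis
  define C where "C = case_prod B o prod_decode"
  have "?O (\<Union>i. A i) \<le> (\<Sum>i. hs_term s (C i))"
  proof (rule hausdorff_pre_le)
    show "(\<Union>i. A i) \<subseteq> (\<Union>i. C i)"
      using B(1) by (auto simp: C_def subset_eq) (metis prod.case prod_encode_inverse)
  qed (auto simp: C_def B split_def)
  also have "\<dots> = (\<Sum>n. \<Sum>i. hs_term s (B n i))"
    unfolding C_def comp_def by (intro suminf_ennreal_2dimen) auto
  also have "\<dots> \<le> (\<Sum>n. ?O (A n) + e * (1/2) ^ Suc n)"
    by (intro suminf_le allI Ble) auto
  also have "... = (\<Sum>n. ?O (A n)) + (\<Sum>n. ennreal e * ennreal ((1/2) ^ Suc n))"
    using \<open>0 < e\<close> by (subst suminf_add[symmetric])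
       (auto simp del: ennreal_suminf_cmult simp add: ennreal_mult[symmetric])
  also have "\<dots> = (\<Sum>n. ?O (A n)) + e"
    unfolding ennreal_suminf_cmult
    by (subst suminf_ennreal_eq[OF zero_le_power power_half_series]) auto
  finally show "?O (\<Union>i. A i) \<le> (\<Sum>n. ?O (A n)) + e" .
qed

lemma hs_term_Int_le:
  assumes "s > 0" "bounded C" shows "hs_term s (C \<inter> A) \<le> hs_term s C"
  using assms diameter_subset[of "C \<inter> A" C] diameter_ge_0[of "C \<inter> A"]
  by (auto simp: hs_term_def bounded_Int intro!: ennreal_leI powr_mono2)

text \<open>Since \<delta> < \<open>d\<close>, no set of an admissible cover meets both
  \<open>A\<close> and \<open>B\<close>. A cover of the union thus splits into covers of the two
  parts without counting any set twice.\<close>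

lemma hausdorff_pre_separated:
  assumes "s > 0" and d: "\<And>a b. a \<in> A \<Longrightarrow> b \<in> B \<Longrightarrow> d \<le> dist a b" and "\<delta> < d" "0 < \<delta>"
  shows "hausdorff_pre s \<delta> A + hausdorff_pre s \<delta> B \<le> hausdorff_pre s \<delta> (A \<union> B)"
  unfolding hausdorff_pre_def[of s \<delta> "A \<union> B"]
proof (rule INF_greatest, safe)
  fix C :: "nat \<Rightarrow> 'a set" assume C: "A \<union> B \<subseteq> (\<Union>i. C i)" "\<forall>i. bounded (C i) \<and> diameter (C i) \<le> \<delta>"
  have le: "hausdorff_pre s \<delta> X \<le> (\<Sum>i. hs_term s (C i \<inter> X))" if "X \<subseteq> A \<union> B" for X
  proof (rule hausdorff_pre_le)
    show "diameter (C i \<inter> X) \<le> \<delta>" for i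
      using diameter_subset[of "C i \<inter> X" "C i"] C(2) by (meson Int_lower1 order_trans)
  qed (use that C in \<open>auto simp: bounded_Int\<close>)
  have "hs_term s (C i \<inter> A) + hs_term s (C i \<inter> B) \<le> hs_term s (C i)" for i
  proof (cases "C i \<inter> A = {} \<or> C i \<inter> B = {}")
    case True
    then show ?thesis
      using hs_term_Int_le[OF assms(1), of "C i"] C(2) by (auto simp: hs_term_def[of s "{}"])
  next
    case False
    then obtain a b where "a \<in> C i" "a \<in> A" "b \<in> C i" "b \<in> B" by auto
    then have "d \<le> diameter (C i)"
      using d[of a b] diameter_bounded_bound[of "C i" a b] C(2) by auto
    with C(2) \<open>\<delta> < d\<close> show ?thesis by (meson not_less order_trans)
  qed
  then have "(\<Sum>i. hs_term s (C i \<inter> A) + hs_term s (C i \<inter> B)) \<le> (\<Sum>i. hs_term s (C i))"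
    by (intro suminf_le) auto
  moreover have "(\<Sum>i. hs_term s (C i \<inter> A) + hs_term s (C i \<inter> B)) =
      (\<Sum>i. hs_term s (C i \<inter> A)) + (\<Sum>i. hs_term s (C i \<inter> B))"
    by (intro suminf_add[symmetric]) auto
  ultimately show "hausdorff_pre s \<delta> A + hausdorff_pre s \<delta> B \<le> (\<Sum>i. hs_term s (C i))"
    using le[of A] le[of B] by (metis add_mono order_trans Un_upper1 Un_upper2)
qed

lemma metric_outer_measure_hausdorff:
  assumes "s > 0"
  shows "metric_outer_measure (hausdorff_measure s)"
proof
  show "hausdorff_measure s {} = 0"
    unfolding hausdorff_measure_def by (simp add: hausdorff_pre_empty)
  show "hausdorff_measure s A \<le> hausdorff_measure s B" if "A \<subseteq> B" for A B :: "'a set"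
    unfolding hausdorff_measure_def by (intro SUP_mono') (rule hausdorff_pre_mono[OF that])
  show "hausdorff_measure s (\<Union>i. S i) \<le> (\<Sum>i. hausdorff_measure s (S i))" for S :: "nat \<Rightarrow> 'a set"
    unfolding hausdorff_measure_def[of s "\<Union>i. S i"]
  proof (rule SUP_least)
    fix \<delta> :: real assume "\<delta> \<in> {0<..}"
    then have "(\<Sum>i. hausdorff_pre s \<delta> (S i)) \<le> (\<Sum>i. hausdorff_measure s (S i))"
      unfolding hausdorff_measure_def by (intro suminf_le SUP_upper) auto
    then show "hausdorff_pre s \<delta> (\<Union>i. S i) \<le> (\<Sum>i. hausdorff_measure s (S i))"
      using hausdorff_pre_UN order_trans by blast
  qed
  show "hausdorff_measure s A + hausdorff_measure s B \<le> hausdorff_measure s (A \<union> B)"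
    if "separated A B" for A B :: "'a set"
  proof -
    from that obtain d where d: "d > 0" "\<forall>a\<in>A. \<forall>b\<in>B. d \<le> dist a b" unfolding separated_def by auto
    \<comment> \<open>Two independent scales, so that the two suprema can be taken one after the
      other.\<close>
    have "hausdorff_pre s \<delta> A + hausdorff_pre s \<delta>' B \<le> hausdorff_measure s (A \<union> B)"
      if "\<delta> > 0" "\<delta>' > 0" for \<delta> \<delta>'
    proof -
      define \<eta> where "\<eta> = min (min \<delta> \<delta>') (d/2)"
      have \<eta>: "\<eta> > 0" "\<eta> < d" "\<eta> \<le> \<delta>" "\<eta> \<le> \<delta>'" using that d by (auto simp: \<eta>_def)
      have "hausdorff_pre s \<delta> A + hausdorff_pre s \<delta>' B \<le> hausdorff_pre s \<eta> A + hausdorff_pre s \<eta> B"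
        using \<eta> by (intro add_mono hausdorff_pre_antimono)
      also have "\<dots> \<le> hausdorff_pre s \<eta> (A \<union> B)"
        using d \<eta> by (intro hausdorff_pre_separated[OF assms]) auto
      also have "\<dots> \<le> hausdorff_measure s (A \<union> B)"
        unfolding hausdorff_measure_def using \<eta> by (intro SUP_upper) auto
      finally show ?thesis .
    qed
    then have "hausdorff_pre s \<delta> A + hausdorff_measure s B \<le> hausdorff_measure s (A \<union> B)" if "\<delta> > 0" for \<delta>
      unfolding hausdorff_measure_def[of s B] using that
      by (subst ennreal_SUP_add_right) (auto intro!: SUP_least)
    then show ?thesis
      unfolding hausdorff_measure_def[of s A]
      by (subst ennreal_SUP_add_left[symmetric]) (auto intro!: SUP_least)
  qed
qed

text \<open>\<open>L\<close> is arbitrary: this is what makes integration over a possibly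
  non-measurable \<Lambda> meaningful.\<close>

lemma metric_outer_measure_Int:
  assumes "metric_outer_measure f" shows "metric_outer_measure (\<lambda>A. f (L \<inter> A))"
proof -
  interpret metric_outer_measure f by fact
  show ?thesis
  proof
    show "f (L \<inter> A) \<le> f (L \<inter> B)" if "A \<subseteq> B" for A B using that by (intro mono) auto
    show "f (L \<inter> (\<Union>i. S i)) \<le> (\<Sum>i. f (L \<inter> S i))" for S :: "nat \<Rightarrow> 'a set"
      using UN_le[of "\<lambda>i. L \<inter> S i"] by simp
    show "f (L \<inter> A) + f (L \<inter> B) \<le> f (L \<inter> (A \<union> B))" if "separated A B" for A B
      using that add_separated_le[of "L \<inter> A" "L \<inter> B"] unfolding Int_Un_distrib separated_def by blast
  qed (simp add: empty)
qed

lemma hausdorff_measure_on_borel: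
  fixes L :: "'a::metric_space set"
  assumes "s > 0"
  obtains M :: "'a measure" where "sets M = sets borel"
    "\<And>A. A \<in> sets borel \<Longrightarrow> emeasure M A = hausdorff_measure s (L \<inter> A)"
proof
  let ?f = "\<lambda>A. hausdorff_measure s (L \<inter> A)"
  define M where "M = measure_of UNIV (sets borel) ?f"
  interpret metric_outer_measure ?f
    by (intro metric_outer_measure_Int metric_outer_measure_hausdorff assms)
  have ms: "measure_space UNIV (sets borel) ?f" by (rule measure_space_borel)
  have [simp]: "sigma_sets UNIV (sets (borel :: 'a measure)) = sets borel"
    using sets.sigma_sets_eq[of "borel :: 'a measure"] by simp
  show "sets M = sets borel" unfolding M_def by simp
  show "emeasure M A = ?f A" if "A \<in> sets borel" for A
    unfolding M_def using ms that
    by (subst emeasure_measure_of_sigma) (auto simp: measure_space_def)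
qed

section \<open>Differentiation of potentials on the ball\<close>

text \<open>The measure lives on the compact sphere and not on the whole space. A kernel continuous
  on \<open>ball 0 1 \<times> sphere 0 1\<close> is then bounded in \<xi> for each fixed
  \<open>x\<close>, hence integrable, and its values for \<xi> off the sphere do not matter.\<close>

locale sphere_measure = finite_measure M for M :: "(real^'n::finite) measure" +
  assumes sets_M: "sets M = sets (restrict_space borel (sphere 0 1))"
begin

text \<open>Values in a Banach space, because gradients are integrated as vectors before components
  are taken.\<close>

definition potential :: "(real^'n \<Rightarrow> real^'n \<Rightarrow> 'b::{banach,second_countable_topology}) \<Rightarrow> real^'n \<Rightarrow> 'b" where
  "potential F x = (LINT \<xi>|M. F x \<xi>)"

lemma space_M: "space M = sphere 0 1"
  using sets_eq_imp_space_eq[OF sets_M] by (simp add: space_restrict_space)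

lemma integrable_continuous:
  fixes f :: "real^'n \<Rightarrow> 'b::{banach,second_countable_topology}"
  assumes "continuous_on (sphere 0 1) f"
  shows "integrable M f"
proof -
  have "compact (f ` sphere 0 1)" using assms by (intro compact_continuous_image) auto
  then obtain B where B: "\<And>\<xi>. \<xi> \<in> sphere 0 1 \<Longrightarrow> norm (f \<xi>) \<le> B"
    using compact_imp_bounded bounded_iff by (metis imageI)
  have "f \<in> borel_measurable M"
    using borel_measurable_continuous_on_restrict[OF assms] measurable_cong_sets[OF sets_M refl] by blast
  then show ?thesis
    by (intro integrable_const_bound[where B=B] AE_I2) (auto simp: B space_M)
qed

lemma integrable_kernel:
  fixes F :: "real^'n \<Rightarrow> real^'n \<Rightarrow> 'b::{banach,second_countable_topology}"
  assumes "continuous_on (ball 0 1 \<times> sphere 0 1) (\<lambda>(x,\<xi>). F x \<xi>)" "x \<in> ball 0 1"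
  shows "integrable M (F x)"
proof (rule integrable_continuous)
  have "continuous_on (sphere 0 1) ((\<lambda>(x,\<xi>). F x \<xi>) \<circ> (\<lambda>\<xi>. (x,\<xi>)))"
    using assms by (intro continuous_on_compose continuous_intros continuous_on_subset[OF assms(1)]) auto
  then show "continuous_on (sphere 0 1) (F x)" by (simp add: o_def)
qed

text \<open>\<open>H\<close> is uniformly continuous on a closed ball around \<open>x\<close> times
  the sphere. The mean value inequality therefore bounds the linearization error of \<open>F\<close>
  by the same multiple of \<open>|y - x|\<close> for every \<xi>, and integration multiplies it only
  by the total mass.\<close>

lemma has_derivative_potential:
  assumes F: "continuous_on (ball 0 1 \<times> sphere 0 1) (\<lambda>(x,\<xi>). F x \<xi>)"
    and H: "continuous_on (ball 0 1 \<times> sphere 0 1) (\<lambda>(x,\<xi>). H x \<xi>)"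
    and deriv: "\<And>x \<xi>. x \<in> ball 0 1 \<Longrightarrow> \<xi> \<in> sphere 0 1 \<Longrightarrow>
      ((\<lambda>x. F x \<xi>) has_derivative (\<lambda>v. v \<bullet> H x \<xi>)) (at x)"
    and x: "x \<in> ball 0 1"
  shows "(potential F has_derivative (\<lambda>v. v \<bullet> potential H x)) (at x)"
  unfolding has_derivative_at_alt
proof (intro conjI allI impI)
  show "bounded_linear (\<lambda>v. v \<bullet> potential H x)" by (rule bounded_linear_inner_left)
  fix e :: real assume "e > 0"
  define m where "m = measure M (space M)"
  \<comment> \<open>\<open>m + 1\<close> instead of \<open>m\<close>, since the total mass may be
    zero.\<close>
  define e' where "e' = e / (m + 1)"
  have m: "m \<ge> 0" by (simp add: m_def)
  have e': "e' > 0" "e' * m \<le> e"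
    using \<open>e > 0\<close> m by (auto simp: e'_def field_simps)
  obtain r where r: "r > 0" "cball x r \<subseteq> ball 0 1"
    using x open_contains_cball[of "ball 0 1"] by (metis open_ball)
  have "uniformly_continuous_on (cball x r \<times> sphere 0 1) (\<lambda>(x,\<xi>). H x \<xi>)"
    using r by (intro compact_uniformly_continuous continuous_on_subset[OF H] compact_Times) auto
  then obtain d where d: "d > 0" and dH: "\<And>p p'. p \<in> cball x r \<times> sphere 0 1 \<Longrightarrow> p' \<in> cball x r \<times> sphere 0 1 \<Longrightarrow>
      dist p' p < d \<Longrightarrow> dist ((\<lambda>(x,\<xi>). H x \<xi>) p') ((\<lambda>(x,\<xi>). H x \<xi>) p) < e'"
    unfolding uniformly_continuous_on_def using \<open>e' > 0\<close> by meson
  define d' where "d' = min d r"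
  have d': "d' > 0" using d r by (simp add: d'_def)
  have Hclose: "norm (H y \<xi> - H x \<xi>) \<le> e'" if "y \<in> ball x d'" "\<xi> \<in> sphere 0 1" for y \<xi>
    using dH[of "(x,\<xi>)" "(y,\<xi>)"] that r by (auto simp: d'_def dist_Pair_Pair dist_norm norm_minus_commute)
  show "\<exists>d>0. \<forall>y. norm (y - x) < d \<longrightarrow>
      norm (potential F y - potential F x - (y - x) \<bullet> potential H x) \<le> e * norm (y - x)"
  proof (intro exI[of _ d'] conjI allI impI d')
    fix y assume y: "norm (y - x) < d'"
    have sub: "ball x d' \<subseteq> ball 0 1" using r by (auto simp: d'_def)
    have yx: "y \<in> ball x d'" "x \<in> ball x d'" using y d' by (auto simp: dist_norm norm_minus_commute)
    have bound: "norm (F y \<xi> - F x \<xi> - (y - x) \<bullet> H x \<xi>) \<le> norm (y - x) * e'" if \<xi>: "\<xi> \<in> sphere 0 1" for \<xi>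
    proof (rule differentiable_bound_linearization[where S="ball x d'" and f="\<lambda>y. F y \<xi>" and f'="\<lambda>y v. v \<bullet> H y \<xi>" and ?x0.0=x])
      show "x + t *\<^sub>R (y - x) \<in> ball x d'" if "t \<in> {0..1}" for t
      proof -
        have "\<bar>t\<bar> * norm (y - x) \<le> 1 * norm (y - x)" using that by (intro mult_right_mono) auto
        then show ?thesis using y by (simp add: dist_norm)
      qed
      show "((\<lambda>y. F y \<xi>) has_derivative (\<lambda>v. v \<bullet> H z \<xi>)) (at z within ball x d')" if "z \<in> ball x d'" for z
        using deriv[OF subsetD[OF sub that] \<xi>] by (rule has_derivative_at_withinI)
      show "onorm ((\<lambda>v. v \<bullet> H z \<xi>) - (\<lambda>v. v \<bullet> H x \<xi>)) \<le> e'" if "z \<in> ball x d'" for z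
      proof (rule onorm_bound)
        fix v
        have "norm (v \<bullet> (H z \<xi> - H x \<xi>)) \<le> norm v * norm (H z \<xi> - H x \<xi>)"
          by (simp add: Cauchy_Schwarz_ineq2)
        also have "\<dots> \<le> norm v * e'" using Hclose[OF that \<xi>] by (intro mult_left_mono) auto
        finally show "norm (((\<lambda>v. v \<bullet> H z \<xi>) - (\<lambda>v. v \<bullet> H x \<xi>)) v) \<le> e' * norm v"
          by (simp add: inner_diff_right mult.commute)
      qed (use e' in auto)
    qed (use yx in auto)
    have y1: "y \<in> ball 0 1" using yx sub by auto
    note [simp] = integrable_kernel[OF F y1] integrable_kernel[OF F x] integrable_kernel[OF H x]
    have "potential F y - potential F x - (y - x) \<bullet> potential H x
      = (LINT \<xi>|M. F y \<xi> - F x \<xi> - (y - x) \<bullet> H x \<xi>)"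
      unfolding potential_def by simp
    also have "norm \<dots> \<le> (LINT \<xi>|M. norm (y - x) * e')"
      by (rule Bochner_Integration.integral_norm_bound_integral) (use bound in \<open>auto simp: space_M\<close>)
    also have "\<dots> = (e' * m) * norm (y - x)" by (simp add: m_def)
    also have "\<dots> \<le> e * norm (y - x)" using e' by (intro mult_right_mono) auto
    finally show "norm (potential F y - potential F x - (y - x) \<bullet> potential H x) \<le> e * norm (y - x)" .
  qed
qed

end

section \<open>A class of kernels closed under differentiation\<close>

definition log_poisson :: "real^'n::finite \<Rightarrow> real^'n \<Rightarrow> real" where
  "log_poisson x \<xi> = ln (1 - x \<bullet> x) - ln ((x - \<xi>) \<bullet> (x - \<xi>))"

definition log_poisson_grad :: "real^'n::finite \<Rightarrow> real^'n \<Rightarrow> real^'n" where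
  "log_poisson_grad x \<xi> = (- 2 * inverse (1 - x \<bullet> x)) *\<^sub>R x + (- 2 * inverse ((x - \<xi>) \<bullet> (x - \<xi>))) *\<^sub>R (x - \<xi>)"

text \<open>Smoothness needs derivatives of every order, for which no closed formula is convenient.
  This class contains the kernels of interest, consists of functions continuous on
  \<open>ball 0 1 \<times> sphere 0 1\<close>, and is stable under partial derivatives in
  \<open>x\<close>. The two inverses are present because they occur in the gradient of
  \<open>log_poisson\<close>.\<close>

inductive kern :: "(real^'n::finite \<Rightarrow> real^'n \<Rightarrow> real) \<Rightarrow> bool" where
  kern_const: "kern (\<lambda>x \<xi>. c)"
| kern_fst: "kern (\<lambda>x \<xi>. x $ i)"
| kern_snd: "kern (\<lambda>x \<xi>. \<xi> $ i)"
| kern_invA: "kern (\<lambda>x \<xi>. inverse (1 - x \<bullet> x))"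
| kern_invB: "kern (\<lambda>x \<xi>. inverse ((x - \<xi>) \<bullet> (x - \<xi>)))"
| kern_log: "kern log_poisson"
| kern_exp: "kern (\<lambda>x \<xi>. exp (c * log_poisson x \<xi>))"
| kern_add: "kern F \<Longrightarrow> kern G \<Longrightarrow> kern (\<lambda>x \<xi>. F x \<xi> + G x \<xi>)"
| kern_mult: "kern F \<Longrightarrow> kern G \<Longrightarrow> kern (\<lambda>x \<xi>. F x \<xi> * G x \<xi>)"

lemma kern_minus: "kern F \<Longrightarrow> kern (\<lambda>x \<xi>. - F x \<xi>)"
  using kern_mult[OF kern_const[of "-1"], of F] by simp

lemma kern_diff: "kern F \<Longrightarrow> kern G \<Longrightarrow> kern (\<lambda>x \<xi>. F x \<xi> - G x \<xi>)"
  using kern_add[OF _ kern_minus, of F G] by simp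

lemmas kern_intros = kern.intros kern_minus kern_diff

lemma poisson_factors_pos:
  assumes "x \<in> ball 0 1" "\<xi> \<in> sphere (0::real^'n::finite) 1"
  shows "1 - x \<bullet> x > 0" "(x - \<xi>) \<bullet> (x - \<xi>) > 0"
proof -
  show "1 - x \<bullet> x > 0" using assms by (simp add: dot_square_norm power_less_one_iff)
  show "(x - \<xi>) \<bullet> (x - \<xi>) > 0" using assms by auto
qed

lemma kern_continuous:
  "kern F \<Longrightarrow> continuous_on (ball 0 1 \<times> sphere 0 1) (\<lambda>(x,\<xi>). F x \<xi>)"
proof (induction rule: kern.induct)
  case kern_log
  show ?case unfolding log_poisson_def split_def
    using poisson_factors_pos by (intro continuous_intros) force+
next
  case (kern_exp c)
  show ?case unfolding log_poisson_def split_def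
    using poisson_factors_pos by (intro continuous_intros) force+
next
  case kern_invA
  show ?case unfolding split_def
    using poisson_factors_pos by (intro continuous_intros) force+
next
  case kern_invB
  show ?case unfolding split_def
    using poisson_factors_pos by (intro continuous_intros) force+
qed (auto simp: split_def intro!: continuous_intros)

lemma kern_continuous_vec:
  assumes "\<And>i. kern (\<lambda>x \<xi>. H x \<xi> $ i)"
  shows "continuous_on (ball 0 1 \<times> sphere 0 1) (\<lambda>(x,\<xi>). H x \<xi>)"
proof -
  have "continuous_on (ball 0 1 \<times> sphere 0 1) (\<lambda>p. \<chi> i. (\<lambda>(x,\<xi>). H x \<xi> $ i) p)"
    by (intro continuous_on_vec_lambda kern_continuous assms)
  then show ?thesis by (simp add: split_def)
qed

lemma has_derivative_one_minus_square:
  "((\<lambda>x. 1 - x \<bullet> x) has_derivative (\<lambda>v. - 2 * (v \<bullet> x))) (at (x::real^'n::finite))"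
  by (rule has_derivative_eq_rhs, (rule derivative_intros)+) (simp add: fun_eq_iff inner_commute)

lemma has_derivative_square_diff:
  "((\<lambda>x. (x - \<xi>) \<bullet> (x - \<xi>)) has_derivative (\<lambda>v. 2 * (v \<bullet> (x - \<xi>)))) (at (x::real^'n::finite))"
  by (rule has_derivative_eq_rhs, (rule derivative_intros)+)
    (simp add: fun_eq_iff inner_commute[of _ "x - \<xi>"])

lemma has_derivative_invA:
  fixes x \<xi> :: "real^'n::finite"
  assumes "x \<in> ball 0 1" "\<xi> \<in> sphere (0::real^'n::finite) 1"
  shows "((\<lambda>x. inverse (1 - x \<bullet> x)) has_derivative (\<lambda>v. v \<bullet> ((2 * (inverse (1 - x \<bullet> x))\<^sup>2) *\<^sub>R x))) (at x)"
  using Deriv.has_derivative_inverse[OF _ has_derivative_one_minus_square[of x]] poisson_factors_pos(1)[OF assms]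
  by (simp add: power2_eq_square ac_simps)

lemma has_derivative_invB:
  assumes "x \<in> ball 0 1" "\<xi> \<in> sphere (0::real^'n::finite) 1"
  shows "((\<lambda>x. inverse ((x - \<xi>) \<bullet> (x - \<xi>))) has_derivative
    (\<lambda>v. v \<bullet> ((- 2 * (inverse ((x - \<xi>) \<bullet> (x - \<xi>)))\<^sup>2) *\<^sub>R (x - \<xi>)))) (at x)"
  using Deriv.has_derivative_inverse[OF _ has_derivative_square_diff[of \<xi> x]] poisson_factors_pos(2)[OF assms]
  by (simp add: power2_eq_square ac_simps)

lemma has_derivative_log_poisson:
  assumes "x \<in> ball 0 1" "\<xi> \<in> sphere (0::real^'n::finite) 1"
  shows "((\<lambda>x. log_poisson x \<xi>) has_derivative (\<lambda>v. v \<bullet> log_poisson_grad x \<xi>)) (at x)"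
proof -
  have "((\<lambda>x. log_poisson x \<xi>) has_derivative
    (\<lambda>v. - 2 * (v \<bullet> x) * inverse (1 - x \<bullet> x) - 2 * (v \<bullet> (x - \<xi>)) * inverse ((x - \<xi>) \<bullet> (x - \<xi>)))) (at x)"
    unfolding log_poisson_def
    by (intro has_derivative_diff has_derivative_ln has_derivative_one_minus_square has_derivative_square_diff
        poisson_factors_pos[OF assms])
  then show ?thesis
    by (rule has_derivative_eq_rhs) (simp only: log_poisson_grad_def inner_add_right inner_scaleR_right fun_eq_iff, simp)
qed

lemma has_derivative_exp_log_poisson:
  assumes "x \<in> ball 0 1" "\<xi> \<in> sphere (0::real^'n::finite) 1"
  shows "((\<lambda>x. exp (c * log_poisson x \<xi>)) has_derivative
    (\<lambda>v. v \<bullet> ((c * exp (c * log_poisson x \<xi>)) *\<^sub>R log_poisson_grad x \<xi>))) (at x)"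
proof -
  have "((\<lambda>x. exp (c * log_poisson x \<xi>)) has_derivative
    (\<lambda>v. c * (v \<bullet> log_poisson_grad x \<xi>) * exp (c * log_poisson x \<xi>))) (at x)"
    by (intro has_derivative_exp has_derivative_mult_right has_derivative_log_poisson assms)
  then show ?thesis by (rule has_derivative_eq_rhs) (simp add: fun_eq_iff)
qed

lemma has_derivative_nth: "((\<lambda>x. x $ i) has_derivative (\<lambda>v. v \<bullet> axis i 1)) (at (x::real^'n::finite))"
  by (simp add: inner_axis bounded_linear_imp_has_derivative bounded_linear_vec_nth)

lemma kern_log_poisson_grad: "kern (\<lambda>x \<xi>. log_poisson_grad x \<xi> $ i)"
  unfolding log_poisson_grad_def by (simp, intro kern_intros)

text \<open>Stability of the class under the gradient in \<open>x\<close>; with it, one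
  differentiation under the integral sign can be iterated indefinitely.\<close>

lemma kern_has_derivative:
  assumes "kern F"
  obtains H where "\<And>i. kern (\<lambda>x \<xi>. H x \<xi> $ i)"
    "\<And>x \<xi>. x \<in> ball 0 1 \<Longrightarrow> \<xi> \<in> sphere 0 1 \<Longrightarrow> ((\<lambda>x. F x \<xi>) has_derivative (\<lambda>v. v \<bullet> H x \<xi>)) (at x)"
proof -
  have "\<exists>H. (\<forall>i. kern (\<lambda>x \<xi>. H x \<xi> $ i)) \<and>
    (\<forall>x\<in>ball 0 1. \<forall>\<xi>\<in>sphere 0 1. ((\<lambda>x. F x \<xi>) has_derivative (\<lambda>v. v \<bullet> H x \<xi>)) (at x))"
    using assms
  proof (induction rule: kern.induct)
    case (kern_const c)
    show ?case by (intro exI[of _ "\<lambda>_ _. 0"]) (auto intro: kern_intros)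
  next
    case (kern_fst i)
    show ?case by (intro exI[of _ "\<lambda>_ _. axis i 1"]) (auto intro: kern_intros has_derivative_nth)
  next
    case (kern_snd i)
    show ?case by (intro exI[of _ "\<lambda>_ _. 0"]) (auto intro: kern_intros)
  next
    case kern_invA
    show ?case
      by (intro exI[of _ "\<lambda>x \<xi>. (2 * (inverse (1 - x \<bullet> x))\<^sup>2) *\<^sub>R x"] conjI allI ballI has_derivative_invA)
        (auto simp: power2_eq_square intro!: kern_intros)
  next
    case kern_invB
    show ?case
      by (intro exI[of _ "\<lambda>x \<xi>. (- 2 * (inverse ((x - \<xi>) \<bullet> (x - \<xi>)))\<^sup>2) *\<^sub>R (x - \<xi>)"] conjI allI ballI has_derivative_invB)
        (auto simp: power2_eq_square intro!: kern_intros)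
  next
    case kern_log
    show ?case
      by (intro exI[of _ log_poisson_grad] conjI allI ballI kern_log_poisson_grad has_derivative_log_poisson)
  next
    case (kern_exp c)
    show ?case
      by (intro exI[of _ "\<lambda>x \<xi>. (c * exp (c * log_poisson x \<xi>)) *\<^sub>R log_poisson_grad x \<xi>"] conjI allI ballI
          has_derivative_exp_log_poisson) (auto intro!: kern_intros kern_log_poisson_grad)
  next
    case (kern_add F G)
    then obtain H K where
      "\<forall>i. kern (\<lambda>x \<xi>. H x \<xi> $ i)" "\<forall>i. kern (\<lambda>x \<xi>. K x \<xi> $ i)" and
      "\<forall>x\<in>ball 0 1. \<forall>\<xi>\<in>sphere 0 1. ((\<lambda>x. F x \<xi>) has_derivative (\<lambda>v. v \<bullet> H x \<xi>)) (at x)"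
      "\<forall>x\<in>ball 0 1. \<forall>\<xi>\<in>sphere 0 1. ((\<lambda>x. G x \<xi>) has_derivative (\<lambda>v. v \<bullet> K x \<xi>)) (at x)"
      by blast
    then show ?case
      by (intro exI[of _ "\<lambda>x \<xi>. H x \<xi> + K x \<xi>"])
        (simp add: kern_intros inner_add_right has_derivative_add)
  next
    case (kern_mult F G)
    then obtain H K where
      "\<forall>i. kern (\<lambda>x \<xi>. H x \<xi> $ i)" "\<forall>i. kern (\<lambda>x \<xi>. K x \<xi> $ i)" and
      "\<forall>x\<in>ball 0 1. \<forall>\<xi>\<in>sphere 0 1. ((\<lambda>x. F x \<xi>) has_derivative (\<lambda>v. v \<bullet> H x \<xi>)) (at x)"
      "\<forall>x\<in>ball 0 1. \<forall>\<xi>\<in>sphere 0 1. ((\<lambda>x. G x \<xi>) has_derivative (\<lambda>v. v \<bullet> K x \<xi>)) (at x)"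
      by blast
    with kern_mult.hyps show ?case
      by (intro exI[of _ "\<lambda>x \<xi>. F x \<xi> *\<^sub>R K x \<xi> + G x \<xi> *\<^sub>R H x \<xi>"])
        (auto simp: inner_add_right mult.commute[of "G _ _"] intro!: kern_intros has_derivative_mult)
  qed
  then show ?thesis using that by blast
qed

lemma partial_deriv_eqI:
  assumes "(f has_derivative (\<lambda>v. v \<bullet> w)) (at x)" shows "partial_deriv i f x = w $ i"
  unfolding partial_deriv_def frechet_derivative_at[OF assms, symmetric]
  by (simp add: inner_axis' )

text \<open>Iterated partial derivatives of a potential are identified only inside the ball. As the
  ball is open, this already determines the next derivative.\<close>

lemma has_derivative_cong_ball:
  assumes "\<And>x. x \<in> ball 0 1 \<Longrightarrow> f x = g x" "x \<in> ball 0 1"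
    and "(g has_derivative (\<lambda>v. v \<bullet> w)) (at x)"
  shows "(f has_derivative (\<lambda>v. v \<bullet> w)) (at x)"
  using has_derivative_transform_within_open[OF assms(3) open_ball assms(2)] assms(1) by metis

context sphere_measure
begin

lemma has_derivative_potential_kern:
  assumes "kern F" "\<And>i. kern (\<lambda>x \<xi>. H x \<xi> $ i)"
    "\<And>x \<xi>. x \<in> ball 0 1 \<Longrightarrow> \<xi> \<in> sphere 0 1 \<Longrightarrow> ((\<lambda>x. F x \<xi>) has_derivative (\<lambda>v. v \<bullet> H x \<xi>)) (at x)"
    "x \<in> ball 0 1"
  shows "(potential F has_derivative (\<lambda>v. v \<bullet> potential H x)) (at x)"
  using assms by (intro has_derivative_potential kern_continuous kern_continuous_vec)

lemma potential_nth:
  assumes "\<And>i. kern (\<lambda>x \<xi>. H x \<xi> $ i)" "x \<in> ball 0 1"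
  shows "potential H x $ i = potential (\<lambda>x \<xi>. H x \<xi> $ i) x"
proof -
  have "potential H x \<bullet> axis i 1 = potential (\<lambda>x \<xi>. H x \<xi> \<bullet> axis i 1) x"
    unfolding potential_def
    by (intro integral_inner_left[symmetric] integrable_kernel[OF kern_continuous_vec] assms)
  then show ?thesis by (simp add: inner_axis)
qed

lemma iter_partial_potential:
  assumes "kern F"
  shows "\<exists>G. kern G \<and> (\<forall>x\<in>ball 0 1. iter_partial is (potential F) x = potential G x)"
proof (induction "is")
  case Nil
  then show ?case using assms by auto
next
  case (Cons i "is")
  then obtain G where G: "kern G" "\<And>x. x \<in> ball 0 1 \<Longrightarrow> iter_partial is (potential F) x = potential G x"
    by auto
  obtain H where H: "\<And>i. kern (\<lambda>x \<xi>. H x \<xi> $ i)"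
    "\<And>x \<xi>. x \<in> ball 0 1 \<Longrightarrow> \<xi> \<in> sphere 0 1 \<Longrightarrow> ((\<lambda>x. G x \<xi>) has_derivative (\<lambda>v. v \<bullet> H x \<xi>)) (at x)"
    using kern_has_derivative[OF G(1)] by metis
  have "iter_partial (i # is) (potential F) x = potential (\<lambda>x \<xi>. H x \<xi> $ i) x" if "x \<in> ball 0 1" for x
    using partial_deriv_eqI[OF has_derivative_cong_ball[OF G(2) that has_derivative_potential_kern[OF G(1) H that]]]
      potential_nth[OF H(1) that] by simp
  with H(1) show ?case by (intro exI[of _ "\<lambda>x \<xi>. H x \<xi> $ i"]) auto
qed

lemma smooth_on_potential:
  assumes "kern F"
  shows "smooth_on (ball 0 1) (potential F)"
  unfolding smooth_on_def differentiable_on_def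
proof (intro allI ballI)
  fix "is" and x :: "real^'n" assume x: "x \<in> ball 0 1"
  obtain G where G: "kern G" "\<And>x. x \<in> ball 0 1 \<Longrightarrow> iter_partial is (potential F) x = potential G x"
    using iter_partial_potential[OF assms] by blast
  obtain H where H: "\<And>i. kern (\<lambda>x \<xi>. H x \<xi> $ i)"
    "\<And>x \<xi>. x \<in> ball 0 1 \<Longrightarrow> \<xi> \<in> sphere 0 1 \<Longrightarrow> ((\<lambda>x. G x \<xi>) has_derivative (\<lambda>v. v \<bullet> H x \<xi>)) (at x)"
    using kern_has_derivative[OF G(1)] by metis
  show "iter_partial is (potential F) differentiable (at x within ball 0 1)"
    using has_derivative_cong_ball[OF G(2) x has_derivative_potential_kern[OF G(1) H x]]
    by (meson differentiable_def has_derivative_at_withinI)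
qed

end

section \<open>The eigenvalue equation for the critical kernel\<close>

definition log_poisson_hess :: "'n \<Rightarrow> real^'n::finite \<Rightarrow> real^'n \<Rightarrow> real^'n" where
  "log_poisson_hess i x \<xi> =
    (- 2 * inverse (1 - x \<bullet> x) - 2 * inverse ((x - \<xi>) \<bullet> (x - \<xi>))) *\<^sub>R axis i 1
    + (- 4 * (inverse (1 - x \<bullet> x))\<^sup>2 * x $ i) *\<^sub>R x
    + (4 * (inverse ((x - \<xi>) \<bullet> (x - \<xi>)))\<^sup>2 * (x $ i - \<xi> $ i)) *\<^sub>R (x - \<xi>)"

lemma has_derivative_log_poisson_grad:
  fixes x \<xi> :: "real^'n::finite"
  assumes "x \<in> ball 0 1" "\<xi> \<in> sphere 0 1"
  shows "((\<lambda>x. log_poisson_grad x \<xi> $ i) has_derivative (\<lambda>v. v \<bullet> log_poisson_hess i x \<xi>)) (at x)"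
proof -
  have aux: "- 2 * (a * p + (2 * a\<^sup>2 * q) * r) - 2 * (b * (p - 0) + (- 2 * b\<^sup>2 * w) * t)
      = (- 2 * a - 2 * b) * p + - 4 * a\<^sup>2 * r * q + 4 * b\<^sup>2 * t * w" for a b p q r t w :: real
    by (simp add: algebra_simps)
  let ?A = "\<lambda>x. inverse (1 - x \<bullet> x)" and ?B = "\<lambda>x. inverse ((x - \<xi>) \<bullet> (x - \<xi>))"
  have "((\<lambda>x. - 2 * (?A x * x $ i) - 2 * (?B x * (x $ i - \<xi> $ i))) has_derivative
    (\<lambda>v. - 2 * (?A x * (v \<bullet> axis i 1) + (v \<bullet> ((2 * (?A x)\<^sup>2) *\<^sub>R x)) * x $ i)
       - 2 * (?B x * (v \<bullet> axis i 1 - 0) + (v \<bullet> ((- 2 * (?B x)\<^sup>2) *\<^sub>R (x - \<xi>))) * (x $ i - \<xi> $ i)))) (at x)"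
    by (intro has_derivative_diff has_derivative_mult_right has_derivative_mult has_derivative_invA[OF assms]
        has_derivative_invB[OF assms] has_derivative_nth has_derivative_const)
  moreover have "(\<lambda>x. log_poisson_grad x \<xi> $ i) = (\<lambda>x. - 2 * (?A x * x $ i) - 2 * (?B x * (x $ i - \<xi> $ i)))"
    by (simp add: log_poisson_grad_def fun_eq_iff)
  moreover have "(\<lambda>v. - 2 * (?A x * (v \<bullet> axis i 1) + (v \<bullet> ((2 * (?A x)\<^sup>2) *\<^sub>R x)) * x $ i)
       - 2 * (?B x * (v \<bullet> axis i 1 - 0) + (v \<bullet> ((- 2 * (?B x)\<^sup>2) *\<^sub>R (x - \<xi>))) * (x $ i - \<xi> $ i)))
     = (\<lambda>v. v \<bullet> log_poisson_hess i x \<xi>)"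
    by (simp only: log_poisson_hess_def inner_add_right inner_scaleR_right fun_eq_iff) (intro allI aux)
  ultimately show ?thesis by simp
qed

lemma kern_log_poisson_hess: "kern (\<lambda>x \<xi>. log_poisson_hess i x \<xi> $ j)"
  unfolding log_poisson_hess_def by (simp add: power2_eq_square, intro kern_intros)

lemma sum_vec_square: "(\<Sum>i\<in>UNIV. (y $ i)\<^sup>2) = y \<bullet> (y::real^'n::finite)"
  by (simp add: inner_vec_def power2_eq_square)

text \<open>Up to sign \<open>ln P\<close> is a Busemann function. After multiplication by the
  conformal factor \<open>A^2 / 4\<close> the identities say that its hyperbolic gradient has length
  1 and its hyperbolic Laplacian is the constant \<open>- (n - 1)\<close>.\<close>

lemma log_poisson_identities:
  fixes x \<xi> :: "real^'n::finite"
  assumes "x \<in> ball 0 1" "\<xi> \<in> sphere 0 1"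
  defines "A \<equiv> 1 - x \<bullet> x"
  shows "log_poisson_grad x \<xi> \<bullet> log_poisson_grad x \<xi> = 4 / A\<^sup>2"
    and "(\<Sum>i\<in>UNIV. log_poisson_hess i x \<xi> $ i) + 2 * (real CARD('n) - 2) / A * (x \<bullet> log_poisson_grad x \<xi>)
      = - 4 * (real CARD('n) - 1) / A\<^sup>2"
proof -
  define B where "B = (x - \<xi>) \<bullet> (x - \<xi>)"
  have pos: "A > 0" "B > 0"
    using poisson_factors_pos[OF assms(1,2)] by (auto simp: A_def B_def)
  have xx: "x \<bullet> x = 1 - A" by (simp add: A_def)
  have "\<xi> \<bullet> \<xi> = 1" using assms by (simp add: dot_square_norm)
  \<comment> \<open>\<open>|\<xi>| = 1\<close> eliminates \<xi>: every inner product involved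
    becomes a polynomial in \<open>A\<close> and \<open>B\<close>, and both claims become rational
    identities in these two numbers.\<close>
  then have x\<xi>: "x \<bullet> (x - \<xi>) = (B - A) / 2"
    by (simp add: A_def B_def inner_diff_left inner_diff_right inner_commute[of \<xi> x] field_simps)
  have grad: "log_poisson_grad x \<xi> = (- 2 / A) *\<^sub>R x + (- 2 / B) *\<^sub>R (x - \<xi>)"
    by (simp add: log_poisson_grad_def A_def B_def divide_inverse)
  have "log_poisson_grad x \<xi> \<bullet> log_poisson_grad x \<xi> =
      4 / A\<^sup>2 * (x \<bullet> x) + 8 / (A * B) * (x \<bullet> (x - \<xi>)) + 4 / B\<^sup>2 * ((x - \<xi>) \<bullet> (x - \<xi>))"
    unfolding grad using pos
    by (simp only: inner_add_left inner_add_right inner_scaleR_left inner_scaleR_right inner_commute[of "x - \<xi>" x])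
      (simp add: field_simps power2_eq_square)
  also have "\<dots> = 4 / A\<^sup>2"
    unfolding xx x\<xi> B_def[symmetric] using pos by (simp add: field_simps power2_eq_square)
  finally show "log_poisson_grad x \<xi> \<bullet> log_poisson_grad x \<xi> = 4 / A\<^sup>2" .
  have "log_poisson_hess i x \<xi> $ i = (- 2 / A - 2 / B) - 4 / A\<^sup>2 * (x $ i)\<^sup>2 + 4 / B\<^sup>2 * ((x - \<xi>) $ i)\<^sup>2" for i
    by (simp add: log_poisson_hess_def A_def[symmetric] B_def[symmetric] divide_inverse power2_eq_square)
  then have W: "(\<Sum>i\<in>UNIV. log_poisson_hess i x \<xi> $ i) =
      real CARD('n) * (- 2 / A - 2 / B) - 4 / A\<^sup>2 * (x \<bullet> x) + 4 / B\<^sup>2 * ((x - \<xi>) \<bullet> (x - \<xi>))"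
    by (simp only: sum.distrib sum_subtractf sum_distrib_left[symmetric] sum_vec_square) (simp add: algebra_simps)
  have xg: "x \<bullet> log_poisson_grad x \<xi> = - 2 / A * (x \<bullet> x) - 2 / B * (x \<bullet> (x - \<xi>))"
    unfolding grad by (simp only: inner_add_right inner_scaleR_right)
  show "(\<Sum>i\<in>UNIV. log_poisson_hess i x \<xi> $ i) + 2 * (real CARD('n) - 2) / A * (x \<bullet> log_poisson_grad x \<xi>)
      = - 4 * (real CARD('n) - 1) / A\<^sup>2"
    unfolding W xg unfolding xx x\<xi> B_def[symmetric] using pos
    by (simp add: field_simps power2_eq_square)
qed

definition critical_kernel :: "real \<Rightarrow> real^'n::finite \<Rightarrow> real^'n \<Rightarrow> real" where
  "critical_kernel h x \<xi> = log_poisson x \<xi> * exp (h * log_poisson x \<xi>)"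

definition critical_grad :: "real \<Rightarrow> real^'n::finite \<Rightarrow> real^'n \<Rightarrow> real^'n" where
  "critical_grad h x \<xi> = ((1 + h * log_poisson x \<xi>) * exp (h * log_poisson x \<xi>)) *\<^sub>R log_poisson_grad x \<xi>"

text \<open>Chain rule for \<Phi>(t) = \<open>t exp (h t)\<close> at
  \<open>t = log_poisson x \<xi>\<close>: the coefficient of the product of gradients is \<Phi>'',
  that of \<open>log_poisson_hess\<close> is \<Phi>'.\<close>

definition critical_hess :: "real \<Rightarrow> 'n \<Rightarrow> real^'n::finite \<Rightarrow> real^'n \<Rightarrow> real^'n" where
  "critical_hess h i x \<xi> =
    ((2 * h + h\<^sup>2 * log_poisson x \<xi>) * exp (h * log_poisson x \<xi>) * log_poisson_grad x \<xi> $ i) *\<^sub>R log_poisson_grad x \<xi>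
    + ((1 + h * log_poisson x \<xi>) * exp (h * log_poisson x \<xi>)) *\<^sub>R log_poisson_hess i x \<xi>"

lemma kern_critical:
  "kern (critical_kernel h)" "kern (\<lambda>x \<xi>. critical_grad h x \<xi> $ i)" "kern (\<lambda>x \<xi>. critical_hess h i x \<xi> $ j)"
  unfolding critical_kernel_def critical_grad_def critical_hess_def
  by (simp_all add: power2_eq_square) (intro kern_intros kern_log_poisson_grad kern_log_poisson_hess)+

lemma has_derivative_critical_kernel:
  fixes x \<xi> :: "real^'n::finite"
  assumes "x \<in> ball 0 1" "\<xi> \<in> sphere 0 1"
  shows "((\<lambda>x. critical_kernel h x \<xi>) has_derivative (\<lambda>v. v \<bullet> critical_grad h x \<xi>)) (at x)"
  unfolding critical_kernel_def critical_grad_def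
  by (rule has_derivative_eq_rhs,
      rule has_derivative_mult[OF has_derivative_log_poisson[OF assms] has_derivative_exp_log_poisson[OF assms]])
    (simp add: fun_eq_iff algebra_simps)

lemma has_derivative_critical_grad:
  fixes x \<xi> :: "real^'n::finite"
  assumes "x \<in> ball 0 1" "\<xi> \<in> sphere 0 1"
  shows "((\<lambda>x. critical_grad h x \<xi> $ i) has_derivative (\<lambda>v. v \<bullet> critical_hess h i x \<xi>)) (at x)"
proof -
  \<comment> \<open>\<Phi>' is written as \<open>exp (h t)\<close> plus \<open>h\<close> times the
    kernel itself, two functions whose gradients are already known.\<close>
  have "((\<lambda>x. (exp (h * log_poisson x \<xi>) + h * critical_kernel h x \<xi>) * log_poisson_grad x \<xi> $ i) has_derivative
     (\<lambda>v. (exp (h * log_poisson x \<xi>) + h * critical_kernel h x \<xi>) * (v \<bullet> log_poisson_hess i x \<xi>) +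
      (v \<bullet> ((h * exp (h * log_poisson x \<xi>)) *\<^sub>R log_poisson_grad x \<xi>) + h * (v \<bullet> critical_grad h x \<xi>)) * log_poisson_grad x \<xi> $ i)) (at x)"
    by (intro has_derivative_mult has_derivative_add has_derivative_mult_right has_derivative_exp_log_poisson[OF assms]
      has_derivative_critical_kernel[OF assms] has_derivative_log_poisson_grad[OF assms])
  then show ?thesis
    by (simp add: critical_grad_def critical_hess_def critical_kernel_def inner_add_right algebra_simps power2_eq_square)
qed

text \<open>By the two identities for \<open>log_poisson\<close> the left-hand side is \<Phi>'' - 2h
  \<Phi>' with \<Phi>(t) = \<open>t exp (h t)\<close>. The terms without \<open>t\<close> cancel
  because \<open>n - 1 = 2h\<close>, which leaves \<open>- h^2\<close> times \<Phi>.\<close>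

lemma critical_kernel_eigen:
  fixes x \<xi> :: "real^'n::finite"
  assumes "x \<in> ball 0 1" "\<xi> \<in> sphere 0 1" and h: "h = (real CARD('n) - 1) / 2"
  shows "((1 - (norm x)\<^sup>2)\<^sup>2 / 4) * ((\<Sum>i\<in>UNIV. critical_hess h i x \<xi> $ i)
      + 2 * (real CARD('n) - 2) / (1 - (norm x)\<^sup>2) * (\<Sum>i\<in>UNIV. x $ i * critical_grad h x \<xi> $ i))
    = - h\<^sup>2 * critical_kernel h x \<xi>"
proof -
  define A where "A = 1 - x \<bullet> x"
  define q where "q = log_poisson x \<xi>"
  define E where "E = exp (h * q)"
  let ?g = "log_poisson_grad x \<xi>" and ?W = "\<Sum>i\<in>UNIV. log_poisson_hess i x \<xi> $ i"
  have pos: "A > 0" using poisson_factors_pos[OF assms(1,2)] by (auto simp: A_def)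
  have n: "real CARD('n) - 1 = 2 * h" using h by simp
  have Ax: "1 - (norm x)\<^sup>2 = A" by (simp add: A_def dot_square_norm)
  note ids = log_poisson_identities[OF assms(1,2), folded A_def]
  have hess: "(\<Sum>i\<in>UNIV. critical_hess h i x \<xi> $ i) = (2*h + h\<^sup>2*q) * E * (?g \<bullet> ?g) + (1 + h*q) * E * ?W"
    unfolding critical_hess_def q_def[symmetric] E_def[symmetric] sum_vec_square[symmetric]
    by (simp add: sum.distrib sum_distrib_left power2_eq_square mult.assoc)
  have grad: "(\<Sum>i\<in>UNIV. x $ i * critical_grad h x \<xi> $ i) = (1 + h*q) * E * (x \<bullet> ?g)"
    unfolding critical_grad_def q_def[symmetric] E_def[symmetric]
    by (simp add: inner_vec_def sum_distrib_left ac_simps)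
  have "(\<Sum>i\<in>UNIV. critical_hess h i x \<xi> $ i)
      + 2 * (real CARD('n) - 2) / A * (\<Sum>i\<in>UNIV. x $ i * critical_grad h x \<xi> $ i)
    = (2*h + h\<^sup>2*q) * E * (?g \<bullet> ?g) + (1 + h*q) * E * (?W + 2 * (real CARD('n) - 2) / A * (x \<bullet> ?g))"
    unfolding hess grad by (simp add: distrib_left)
  also have "\<dots> = 4 / A\<^sup>2 * (- h\<^sup>2 * q * E)"
    unfolding ids n using pos by (simp add: field_simps power2_eq_square)
  finally show ?thesis
    unfolding Ax critical_kernel_def q_def[symmetric] E_def[symmetric] using pos by (simp add: field_simps)
qed

context sphere_measure
begin

lemma hyp_laplacian_potential_critical:
  assumes x: "x \<in> ball 0 1" and h: "h = (real CARD('n) - 1) / 2"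
  shows "hyp_laplacian (potential (critical_kernel h)) x = - h\<^sup>2 * potential (critical_kernel h) x"
proof -
  let ?u = "potential (critical_kernel h)"
  note intK = integrable_kernel[OF kern_continuous]
  \<comment> \<open>Needed on the whole ball and not only at \<open>x\<close>, since the second
    derivative differentiates this identity.\<close>
  have p1: "partial_deriv i ?u y = potential (\<lambda>x \<xi>. critical_grad h x \<xi> $ i) y" if "y \<in> ball 0 1" for i y
    using partial_deriv_eqI[OF has_derivative_potential_kern[OF kern_critical(1,2) has_derivative_critical_kernel that]]
      potential_nth[OF kern_critical(2) that] by simp
  have p2: "partial_deriv i (partial_deriv i ?u) x = potential (\<lambda>x \<xi>. critical_hess h i x \<xi> $ i) x" for i
    using partial_deriv_eqI[OF has_derivative_cong_ball[OF p1 x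
        has_derivative_potential_kern[OF kern_critical(2,3) has_derivative_critical_grad x]]]
      potential_nth[OF kern_critical(3) x] by simp
  have int [simp]: "integrable M (\<lambda>\<xi>. critical_grad h x \<xi> $ i)" "integrable M (\<lambda>\<xi>. critical_hess h i x \<xi> $ i)" for i
    using intK[OF kern_critical(2) x] intK[OF kern_critical(3) x] by auto
  have "hyp_laplacian ?u x = (LINT \<xi>|M. ((1 - (norm x)\<^sup>2)\<^sup>2 / 4) * ((\<Sum>i\<in>UNIV. critical_hess h i x \<xi> $ i)
      + 2 * (real CARD('n) - 2) / (1 - (norm x)\<^sup>2) * (\<Sum>i\<in>UNIV. x $ i * critical_grad h x \<xi> $ i)))"
    unfolding hyp_laplacian_def euclid_laplacian_def p1[OF x] p2
    unfolding potential_def by (simp add: Bochner_Integration.integral_sum)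
  also have "\<dots> = (LINT \<xi>|M. - h\<^sup>2 * critical_kernel h x \<xi>)"
    by (intro Bochner_Integration.integral_cong refl critical_kernel_eigen x h) (simp add: space_M)
  finally show ?thesis by (simp add: potential_def)
qed

end

section \<open>Size and sign of the critical potential\<close>

lemma poisson_distance_bounds:
  fixes x \<xi> :: "real^'n::finite"
  assumes "x \<in> ball 0 1" "\<xi> \<in> sphere 0 1"
  shows "1 - norm x \<le> norm (x - \<xi>)" "norm (x - \<xi>) \<le> 1 + norm x"
  using assms norm_triangle_ineq3[of \<xi> x] norm_triangle_ineq4[of x \<xi>] by (auto simp: norm_minus_commute)

text \<open>With \<open>1 - |x|^2\<close> factored, later comparisons with \<epsilon> =
  \<open>1 - |x|\<close> and with the hyperbolic distance are linear in the logarithms.\<close>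

lemma log_poisson_eq:
  fixes x \<xi> :: "real^'n::finite"
  assumes "x \<in> ball 0 1" "\<xi> \<in> sphere 0 1"
  shows "log_poisson x \<xi> = ln (1 - norm x) + ln (1 + norm x) - 2 * ln (norm (x - \<xi>))"
proof -
  have n: "norm x < 1" using assms by simp
  have "1 - x \<bullet> x = (1 - norm x) * (1 + norm x)"
    by (simp add: dot_square_norm power2_eq_square algebra_simps)
  moreover have "ln ((1 - norm x) * (1 + norm x)) = ln (1 - norm x) + ln (1 + norm x)"
    using n norm_ge_zero[of x] by (intro ln_mult_pos) linarith+
  moreover have "norm (x - \<xi>) > 0" using assms by auto
  ultimately show ?thesis
    by (simp add: log_poisson_def dot_square_norm ln_realpow)
qed

lemma hyp_dist_0:
  fixes x :: "real^'n::finite"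
  assumes "x \<in> ball 0 1"
  shows "hyp_dist x 0 = ln (1 + norm x) - ln (1 - norm x)"
proof -
  define t where "t = norm x"
  have t: "0 \<le> t" "t < 1" using assms by (auto simp: t_def)
  have t2: "1 - t\<^sup>2 > 0" using t by (simp add: power_less_one_iff)
  have fac: "1 - t\<^sup>2 = (1 - t) * (1 + t)" by (simp add: power2_eq_square algebra_simps)
  \<comment> \<open>\<open>y\<close> is \<open>cosh d\<close>. Its square minus 1 is the square of a
    rational function of \<open>t\<close>, so the root in the formula for \<open>arcosh\<close>
    disappears.\<close>
  define y where "y = 1 + 2 * t\<^sup>2 / (1 - t\<^sup>2)"
  have y: "y = (1 + t\<^sup>2) / (1 - t\<^sup>2)" unfolding y_def using t2 by (simp add: field_simps)
  have y1: "y \<ge> 1" unfolding y_def using t2 by simp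
  have "y\<^sup>2 - 1 = ((1 + t\<^sup>2)\<^sup>2 - (1 - t\<^sup>2)\<^sup>2) / (1 - t\<^sup>2)\<^sup>2"
    unfolding y using t2 by (simp add: power_divide diff_divide_distrib)
  also have "(1 + t\<^sup>2)\<^sup>2 - (1 - t\<^sup>2)\<^sup>2 = (2 * t)\<^sup>2" by (simp add: power2_eq_square algebra_simps)
  finally have "y\<^sup>2 - 1 = (2 * t / (1 - t\<^sup>2))\<^sup>2" by (simp add: power_divide)
  then have "sqrt (y\<^sup>2 - 1) = 2 * t / (1 - t\<^sup>2)"
    using t t2 by simp
  then have "y + sqrt (y\<^sup>2 - 1) = (1 + t)\<^sup>2 / (1 - t\<^sup>2)"
    unfolding y by (simp add: power2_eq_square add_divide_distrib[symmetric] algebra_simps)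
  also have "\<dots> = (1 + t) / (1 - t)"
    unfolding fac using t by (simp add: power2_eq_square)
  finally have "arcosh y = ln ((1 + t) / (1 - t))" using arcosh_real_def[OF y1] by simp
  also have "\<dots> = ln (1 + t) - ln (1 - t)" using t by (simp add: ln_divide_pos)
  finally show ?thesis by (simp add: hyp_dist_def y_def t_def)
qed

text \<open>The extreme values \<open>1 - |x|\<close> and \<open>1 + |x|\<close> of the Euclidean
  distance from \<open>x\<close> to the sphere turn \<open>ln P\<close> into exactly
  \<open>d\<close> and \<open>- d\<close>.\<close>

lemma abs_log_poisson_le_hyp_dist:
  fixes x \<xi> :: "real^'n::finite"
  assumes "x \<in> ball 0 1" "\<xi> \<in> sphere 0 1"
  shows "\<bar>log_poisson x \<xi>\<bar> \<le> hyp_dist x 0"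
proof -
  note d = poisson_distance_bounds[OF assms]
  have "norm x < 1" using assms by simp
  then have "ln (1 - norm x) \<le> ln (norm (x - \<xi>))" "ln (norm (x - \<xi>)) \<le> ln (1 + norm x)"
    using d by (intro ln_mono; linarith)+
  then show ?thesis
    unfolding log_poisson_eq[OF assms] hyp_dist_0[OF assms(1)] by linarith
qed

context sphere_measure
begin

text \<open>The exponent \<open>b\<close> is kept free of \<open>h\<close> because two values are
  used: \<open>b = h\<close> for the decay of the potential, and some \<open>b < h\<close> to
  control its negative part near \<Lambda>.\<close>

lemma potential_exp_bound:
  fixes b s K :: real
  assumes growth: "\<And>x r. r > 0 \<Longrightarrow> emeasure M (ball x r \<inter> sphere 0 1) \<le> ennreal (K * (2 * r) powr s)"
    and "K > 0" "s > 0" "s < 2 * b" and x: "x \<in> ball 0 1"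
  shows "potential (\<lambda>x \<xi>. exp (b * log_poisson x \<xi>)) x
    \<le> K * 4 powr s * 2 powr b / (1 - 2 powr (s - 2 * b)) * (1 - norm x) powr (s - b)"
proof -
  define \<epsilon> where "\<epsilon> = 1 - norm x"
  have \<epsilon>: "\<epsilon> > 0" using x by (simp add: \<epsilon>_def)
  have b: "b > 0" using assms by linarith
  \<comment> \<open>Upper bound for \<open>P^b\<close> at distance at least
    \<open>2^k \<epsilon>\<close> from \<open>x\<close>, using
    \<open>1 - |x|^2 \<le> 2 \<epsilon>\<close>.\<close>
  define t where "t k = (2 * \<epsilon>) powr b * (2 ^ k * \<epsilon>) powr (- 2 * b)" for k :: nat
  \<comment> \<open>Full balls instead of annuli: they overlap, which only enlarges the sum, and the
    growth hypothesis applies to them directly.\<close>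
  define S where "S k = ball x (2 ^ Suc k * \<epsilon>) \<inter> sphere 0 1" for k :: nat
  define C where "C = K * 4 powr s * 2 powr b * \<epsilon> powr (s - b)"
  define \<rho> where "\<rho> = (2::real) powr (s - 2 * b)"
  have t0: "t k \<ge> 0" for k by (simp add: t_def)
  have \<rho>: "0 < \<rho>" "\<rho> < 1" using assms by (auto simp: \<rho>_def powr_less_one)
  have C0: "C \<ge> 0" using assms by (simp add: C_def)
  have S_sets: "S k \<in> sets M" for k
    unfolding S_def sets_M sets_restrict_space by auto
  have pw: "exp (b * log_poisson x \<xi>) \<le> t k" if "\<xi> \<in> sphere 0 1" "2 ^ k * \<epsilon> \<le> norm (x - \<xi>)" for \<xi> k
  proof -
    have "ln (1 + norm x) \<le> ln 2" using x by (intro ln_mono) (auto simp: add_pos_nonneg)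
    moreover have "ln (2 ^ k * \<epsilon>) \<le> ln (norm (x - \<xi>))"
      using that \<epsilon> by (intro ln_mono) auto
    moreover have "ln (2 * \<epsilon>) = ln 2 + ln \<epsilon>" using \<epsilon> by (simp add: ln_mult_pos)
    ultimately have "log_poisson x \<xi> \<le> ln (2 * \<epsilon>) - 2 * ln (2 ^ k * \<epsilon>)"
      unfolding log_poisson_eq[OF x that(1)] \<epsilon>_def[symmetric] by linarith
    then have "exp (b * log_poisson x \<xi>) \<le> exp (b * (ln (2 * \<epsilon>) - 2 * ln (2 ^ k * \<epsilon>)))"
      using b by simp
    also have "\<dots> = t k"
      using \<epsilon> by (simp add: t_def powr_def exp_add[symmetric] algebra_simps)
    finally show ?thesis .
  qed
  have shell: "\<exists>k. 2 ^ k * \<epsilon> \<le> norm (x - \<xi>) \<and> \<xi> \<in> S k" if \<xi>: "\<xi> \<in> sphere 0 1" for \<xi>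
  proof -
    define Q where "Q k \<longleftrightarrow> norm (x - \<xi>) < 2 ^ Suc k * \<epsilon>" for k
    obtain m where m: "norm (x - \<xi>) / \<epsilon> < 2 ^ m" using real_arch_pow[of 2] by auto
    have "(2::real) ^ m \<le> 2 ^ Suc m" by simp
    with m have "norm (x - \<xi>) / \<epsilon> < 2 ^ Suc m" by linarith
    then have "Q m" using \<epsilon> unfolding Q_def by (simp add: field_simps)
    define k where "k = (LEAST k. Q k)"
    have Qk: "Q k" unfolding k_def by (rule LeastI[of Q, OF \<open>Q m\<close>])
    have "2 ^ k * \<epsilon> \<le> norm (x - \<xi>)"
    \<comment> \<open>For \<open>k = 0\<close> the bound is the distance from \<open>x\<close> to
      the sphere; for larger \<open>k\<close> it comes from minimality.\<close>
    proof (cases k)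
      case 0
      then show ?thesis using poisson_distance_bounds(1)[OF x \<xi>] by (simp add: \<epsilon>_def)
    next
      case (Suc j)
      then have "\<not> Q j" using not_less_Least[of j Q] unfolding k_def by simp
      then show ?thesis using Suc by (simp add: Q_def)
    qed
    then show ?thesis using Qk \<xi> by (auto simp: Q_def S_def dist_norm)
  qed
  \<comment> \<open>The radius \<open>2^(k+1) \<epsilon>\<close> is doubled once more by the growth
    bound, hence \<open>4 powr s\<close>. The powers of \<open>2^k\<close> combine to
    \<open>\<rho>^k\<close>, and \<open>s < 2b\<close> is the condition \<rho> < 1.\<close>
  have termk: "t k * (K * (2 * (2 ^ Suc k * \<epsilon>)) powr s) = C * \<rho> ^ k" for k
  proof -
    have two: "(2 ^ k) powr a = ((2::real) powr a) ^ k" for a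
      by (simp add: powr_realpow[symmetric] powr_powr mult.commute)
    have e: "\<epsilon> powr b * \<epsilon> powr (- 2 * b) * \<epsilon> powr s = \<epsilon> powr (s - b)"
      by (simp add: powr_add[symmetric])
    have r: "\<rho> ^ k = (2 powr (- 2 * b)) ^ k * (2 powr s) ^ k"
      by (simp add: \<rho>_def power_mult_distrib[symmetric] powr_add[symmetric])
    have "2 * (2 ^ Suc k * \<epsilon>) = 4 * (2 ^ k * \<epsilon>)" by simp
    then have "t k * (K * (2 * (2 ^ Suc k * \<epsilon>)) powr s) =
      (2 powr b * \<epsilon> powr b) * ((2 powr (- 2 * b)) ^ k * \<epsilon> powr (- 2 * b)) * (K * (4 powr s * ((2 powr s) ^ k * \<epsilon> powr s)))"
      using \<epsilon> by (simp only: t_def powr_mult two)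
    also have "\<dots> = K * 4 powr s * 2 powr b * (\<epsilon> powr b * \<epsilon> powr (- 2 * b) * \<epsilon> powr s)
        * ((2 powr (- 2 * b)) ^ k * (2 powr s) ^ k)"
      by (simp only: ac_simps)
    finally show ?thesis unfolding e r[symmetric] C_def .
  qed
  have int: "integrable M (\<lambda>\<xi>. exp (b * log_poisson x \<xi>))"
    by (rule integrable_kernel[OF kern_continuous[OF kern_exp] x])
  have "ennreal (potential (\<lambda>x \<xi>. exp (b * log_poisson x \<xi>)) x) = (\<integral>\<^sup>+\<xi>. ennreal (exp (b * log_poisson x \<xi>)) \<partial>M)"
    unfolding potential_def using int by (intro nn_integral_eq_integral[symmetric]) auto
  also have "\<dots> \<le> (\<integral>\<^sup>+\<xi>. (\<Sum>k. ennreal (t k) * indicator (S k) \<xi>) \<partial>M)"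
  proof (rule nn_integral_mono)
    fix \<xi> assume "\<xi> \<in> space M"
    then have \<xi>: "\<xi> \<in> sphere 0 1" by (simp add: space_M)
    from shell[OF \<xi>] obtain k where k: "2 ^ k * \<epsilon> \<le> norm (x - \<xi>)" "\<xi> \<in> S k" by auto
    have "ennreal (exp (b * log_poisson x \<xi>)) \<le> ennreal (t k) * indicator (S k) \<xi>"
      using pw[OF \<xi> k(1)] k(2) by (simp add: ennreal_leI)
    also have "\<dots> = (\<Sum>j\<in>{k}. ennreal (t j) * indicator (S j) \<xi>)"
      by (simp only: sum.insert sum.empty finite.emptyI empty_iff not_False_eq_True add_0_right)
    also have "\<dots> \<le> (\<Sum>k. ennreal (t k) * indicator (S k) \<xi>)" by (rule sum_le_suminf) auto
    finally show "ennreal (exp (b * log_poisson x \<xi>)) \<le> (\<Sum>k. ennreal (t k) * indicator (S k) \<xi>)" .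
  qed
  also have "\<dots> = (\<Sum>k. ennreal (t k) * emeasure M (S k))"
    using S_sets by (subst nn_integral_suminf) (auto simp: nn_integral_cmult_indicator)
  also have "\<dots> \<le> (\<Sum>k. ennreal (C * \<rho> ^ k))"
  proof (intro suminf_le)
    fix k
    have "ennreal (t k) * emeasure M (S k) \<le> ennreal (t k) * ennreal (K * (2 * (2 ^ Suc k * \<epsilon>)) powr s)"
      unfolding S_def using \<epsilon> by (intro mult_left_mono growth) auto
    also have "\<dots> = ennreal (C * \<rho> ^ k)"
      using t0 assms by (subst ennreal_mult[symmetric]) (auto simp: termk[symmetric])
    finally show "ennreal (t k) * emeasure M (S k) \<le> ennreal (C * \<rho> ^ k)" .
  qed auto
  also have "\<dots> = ennreal (C * (1 / (1 - \<rho>)))"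
    using C0 \<rho> by (intro suminf_ennreal_eq sums_mult geometric_sums) auto
  finally have "potential (\<lambda>x \<xi>. exp (b * log_poisson x \<xi>)) x \<le> C * (1 / (1 - \<rho>))"
    using C0 \<rho> by (simp add: ennreal_le_iff)
  then show ?thesis by (simp add: C_def \<rho>_def \<epsilon>_def algebra_simps)
qed

text \<open>The bound for \<open>P^h\<close> carries a factor \<open>2 powr h\<close>. Passing from
  \<open>1 - |x|\<close> to the distance through
  \<open>1 - |x| = (1 + |x|) exp (- d) \<le> 2 exp (- d)\<close> adds \<open>2 powr (s - h)\<close>;
  together they give the \<open>2 powr s\<close> of the constant.\<close>

lemma potential_critical_bound:
  fixes h s K :: real
  assumes growth: "\<And>x r. r > 0 \<Longrightarrow> emeasure M (ball x r \<inter> sphere 0 1) \<le> ennreal (K * (2 * r) powr s)"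
    and "K > 0" "h > 0" "h < s" "s < 2 * h" and x: "x \<in> ball 0 1"
  shows "\<bar>potential (critical_kernel h) x\<bar>
    \<le> K * 4 powr s * 2 powr s / (1 - 2 powr (s - 2 * h)) * (hyp_dist x 0 + 1) * exp (- (s - h) * hyp_dist x 0)"
proof -
  define d where "d = hyp_dist x 0"
  define C where "C = K * 4 powr s * 2 powr h / (1 - 2 powr (s - 2 * h))"
  have n: "norm x < 1" using x by simp
  have C0: "C \<ge> 0" using assms powr_less_one[of 2 "s - 2 * h"] by (simp add: C_def)
  have d0: "d \<ge> 0"
    unfolding d_def hyp_dist_0[OF x] using n norm_ge_zero[of x] by (simp add: ln_mono)
  have int: "integrable M (\<lambda>\<xi>. exp (h * log_poisson x \<xi>))" "integrable M (critical_kernel h x)"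
    by (rule integrable_kernel[OF kern_continuous[OF kern_exp] x]
        integrable_kernel[OF kern_continuous[OF kern_critical(1)] x])+
  have "norm (potential (critical_kernel h) x) \<le> (LINT \<xi>|M. d * exp (h * log_poisson x \<xi>))"
    unfolding potential_def
  proof (rule Bochner_Integration.integral_norm_bound_integral)
    show "norm (critical_kernel h x \<xi>) \<le> d * exp (h * log_poisson x \<xi>)" if "\<xi> \<in> space M" for \<xi>
      using abs_log_poisson_le_hyp_dist[OF x, of \<xi>] that
      by (simp add: critical_kernel_def abs_mult space_M d_def mult_right_mono)
  qed (use int in auto)
  also have "\<dots> = d * potential (\<lambda>x \<xi>. exp (h * log_poisson x \<xi>)) x"
    by (simp add: potential_def)
  also have "\<dots> \<le> d * (C * (1 - norm x) powr (s - h))"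
    unfolding C_def using assms d0 by (intro mult_left_mono potential_exp_bound growth) auto
  also have "\<dots> \<le> d * (C * (2 powr (s - h) * exp (- (s - h) * d)))"
  proof (intro mult_left_mono d0 C0)
    have "ln (1 + norm x) \<le> ln 2" using n norm_ge_zero[of x] by (intro ln_mono) linarith+
    then have "ln (1 - norm x) \<le> ln 2 - d" unfolding d_def hyp_dist_0[OF x] by linarith
    then have "(s - h) * ln (1 - norm x) \<le> (s - h) * (ln 2 - d)" using assms by (intro mult_left_mono) auto
    then have "exp ((s - h) * ln (1 - norm x)) \<le> exp ((s - h) * ln 2) * exp (- (s - h) * d)"
      by (simp add: exp_add[symmetric] algebra_simps)
    then show "(1 - norm x) powr (s - h) \<le> 2 powr (s - h) * exp (- (s - h) * d)"
      using n by (simp add: powr_def)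
  qed
  also have "\<dots> = C * 2 powr (s - h) * d * exp (- (s - h) * d)" by simp
  also have "\<dots> \<le> C * 2 powr (s - h) * (d + 1) * exp (- (s - h) * d)"
    using C0 by (intro mult_right_mono mult_left_mono) auto
  also have "C * 2 powr (s - h) = K * 4 powr s * 2 powr s / (1 - 2 powr (s - 2 * h))"
    by (simp add: C_def powr_diff)
  finally show ?thesis by (simp add: d_def)
qed

lemma potential_critical_pos:
  fixes h s K c :: real
  assumes growth: "\<And>x r. r > 0 \<Longrightarrow> emeasure M (ball x r \<inter> sphere 0 1) \<le> ennreal (K * (2 * r) powr s)"
    and "K > 0" "h > 0" "h < s" "s < 2 * h" and p: "p \<in> sphere 0 1"
    and c: "c > 0" "\<forall>\<^sub>F r in at_right 0. ennreal (c * r powr s) \<le> emeasure M (ball p r \<inter> sphere 0 1)"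
  shows "\<forall>\<^sub>F r in at_right 0. potential (critical_kernel h) ((1 - r) *\<^sub>R p) > 0"
proof -
  \<comment> \<open>The midpoint of \<open>s/2\<close> and \<open>h\<close>: \<open>b < h\<close>
    gives \<open>a > 0\<close>, and \<open>s < 2b\<close> makes \<open>potential_exp_bound\<close>
    applicable.\<close>
  define b where "b = (h + s / 2) / 2"
  define a where "a = h - b"
  have ab: "a > 0" "s < 2 * b" using assms by (auto simp: a_def b_def field_simps)
  \<comment> \<open>The constant of \<open>potential_exp_bound\<close> at exponent \<open>b\<close>,
    divided by \<open>a\<close> as in the pointwise bound for the negative part.\<close>
  define C where "C = K * 4 powr s * 2 powr b / (1 - 2 powr (s - 2 * b)) / a"
  have "((\<lambda>r. C * r powr a) \<longlongrightarrow> C * 0 powr a) (at_right 0)"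
    using ab by (intro tendsto_intros tendsto_powr') (auto simp: eventually_at_right_less intro: eventually_at_rightI[of 0 1])
  \<comment> \<open>\<open>c 4^(-h)\<close> is the coefficient of \<open>r powr (s - h)\<close> in
    the main term; it has to beat the error coefficient \<open>C r^a\<close>.\<close>
  then have "\<forall>\<^sub>F r in at_right 0. C * r powr a < c * 4 powr (- h)"
    using c ab by (intro order_tendstoD(2)) auto
  moreover have "\<forall>\<^sub>F r in at_right (0::real). r > 0" by (rule eventually_at_right_less)
  moreover have "\<forall>\<^sub>F r in at_right (0::real). r < 1/12"
    by (rule eventually_at_rightI[of _ "1/12"]) auto
  ultimately show ?thesis using c(2)
  proof eventually_elim
    case (elim r)
    define x where "x = (1 - r) *\<^sub>R p"
    have nx: "norm x = 1 - r" using p elim by (simp add: x_def)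
    have x: "x \<in> ball 0 1" using nx elim by simp
    let ?S = "ball p r \<inter> sphere 0 1"
    have S: "?S \<in> sets M" unfolding sets_M sets_restrict_space by auto
    have pw: "(4 * r) powr (- h) * indicator ?S \<xi> - exp (b * log_poisson x \<xi>) / a \<le> critical_kernel h x \<xi>"
      if \<xi>: "\<xi> \<in> sphere 0 1" for \<xi>
    proof -
      define q where "q = log_poisson x \<xi>"
      \<comment> \<open>From \<open>y \<le> exp y\<close> with \<open>y = - a q\<close> one gets
        \<open>q exp (a q) \<ge> - 1/a\<close>. Multiplication by \<open>exp (b q)\<close>, where
        \<open>a + b = h\<close>, bounds the kernel below by \<open>- P^b / a\<close>
        everywhere.\<close>
      have "- (a * q) \<le> exp (- (a * q))" using exp_ge_add_one_self[of "- (a * q)"] by linarith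
      then have "- (a * q) * exp (a * q) \<le> exp (- (a * q)) * exp (a * q)"
        by (intro mult_right_mono) auto
      then have "- 1 / a \<le> q * exp (a * q)"
        using ab by (simp add: exp_minus field_simps)
      then have "- 1 / a * exp (b * q) \<le> (q * exp (a * q)) * exp (b * q)"
        by (intro mult_right_mono) auto
      also have "\<dots> = critical_kernel h x \<xi>"
        by (simp add: critical_kernel_def q_def[symmetric] a_def exp_add[symmetric] algebra_simps)
      finally have low: "- exp (b * q) / a \<le> critical_kernel h x \<xi>" by simp
      show ?thesis
      proof (cases "\<xi> \<in> ?S")
        case True
        have "norm (x - \<xi>) \<le> norm (x - p) + norm (p - \<xi>)" using norm_triangle_ineq[of "x - p" "p - \<xi>"] by simp
        also have "x - p = (- r) *\<^sub>R p" by (simp add: x_def algebra_simps)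
        also have "norm \<dots> = r" using p elim by simp
        finally have "norm (x - \<xi>) < 2 * r" using True by (simp add: dist_norm)
        moreover have "norm (x - \<xi>) > 0" using x \<xi> by auto
        ultimately have "ln (norm (x - \<xi>)) \<le> ln (2 * r)" by (intro ln_mono) auto
        moreover have "ln (2 * r) = ln 2 + ln r" "ln (4 * r) = ln 4 + ln r" using elim by (auto simp: ln_mult_pos)
        moreover have "ln (4::real) = 2 * ln 2" using ln_realpow[of 2 2] by simp
        moreover have "ln (1 + norm x) \<ge> 0" by simp
        \<comment> \<open>Here \<open>1 - |x| = r\<close>, \<open>1 + |x| \<ge> 1\<close> and
          \<open>|x - \<xi>| < 2r\<close>, so \<open>P\<close> is at least
          \<open>r / (2r)^2 = 1 / (4r)\<close>.\<close>
        ultimately have q: "q \<ge> - ln (4 * r)"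
          unfolding q_def log_poisson_eq[OF x \<xi>] nx by auto
        \<comment> \<open>The condition \<open>r < 1/12\<close> together with
          \<open>exp 1 \<le> 3\<close> gives \<open>4r \<le> exp (- 1)\<close>. Hence
          \<open>q \<ge> 1\<close>, and the factor \<open>q\<close> of the kernel can be bounded
          below by 1.\<close>
        have "ln (4 * r) \<le> ln (exp (-1))"
        proof (rule ln_mono)
          have "4 * r * exp 1 \<le> 4 * r * 3" using elim exp_le by (intro mult_left_mono) auto
          then have "4 * r * exp 1 \<le> 1" using elim by linarith
          then show "4 * r \<le> exp (- 1)" by (simp add: exp_minus field_simps)
        qed (use elim in auto)
        with q have q1: "q \<ge> 1" by simp
        have "(4 * r) powr (- h) = exp (h * - ln (4 * r))" using elim by (simp add: powr_def)
        also have "\<dots> \<le> exp (h * q)" using mult_left_mono[OF q, of h] \<open>h > 0\<close> by simp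
        also have "\<dots> \<le> q * exp (h * q)" using q1 by simp
        also have "\<dots> = critical_kernel h x \<xi>" by (simp add: critical_kernel_def q_def)
        finally have "(4 * r) powr (- h) \<le> critical_kernel h x \<xi>" .
        moreover have "exp (b * q) / a \<ge> 0" using ab by simp
        ultimately show ?thesis using True by (simp add: q_def)
      qed (use low in \<open>simp add: q_def\<close>)
    qed
    have int: "integrable M (\<lambda>\<xi>. exp (b * log_poisson x \<xi>))" "integrable M (critical_kernel h x)"
      by (rule integrable_kernel[OF kern_continuous[OF kern_exp] x]
          integrable_kernel[OF kern_continuous[OF kern_critical(1)] x])+
    have intS: "integrable M (indicator ?S :: _ \<Rightarrow> real)"
      using S by (simp add: integrable_indicator_iff emeasure_finite less_top[symmetric])
    have "(LINT \<xi>|M. (4 * r) powr (- h) * indicator ?S \<xi> - exp (b * log_poisson x \<xi>) / a) \<le> potential (critical_kernel h) x"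
      unfolding potential_def using pw int intS by (intro integral_mono) (auto simp: space_M)
    also have "(LINT \<xi>|M. (4 * r) powr (- h) * indicator ?S \<xi> - exp (b * log_poisson x \<xi>) / a)
      = (4 * r) powr (- h) * measure M ?S - potential (\<lambda>x \<xi>. exp (b * log_poisson x \<xi>)) x / a"
      unfolding potential_def using int intS S by (simp add: space_M)
    finally have 1: "(4 * r) powr (- h) * measure M ?S - potential (\<lambda>x \<xi>. exp (b * log_poisson x \<xi>)) x / a
      \<le> potential (critical_kernel h) x" .
    have "c * r powr s \<le> measure M ?S"
      using elim(4) by (simp add: emeasure_eq_measure)
    then have 2: "(4 * r) powr (- h) * (c * r powr s) \<le> (4 * r) powr (- h) * measure M ?S"
      by (intro mult_left_mono) auto
    have "potential (\<lambda>x \<xi>. exp (b * log_poisson x \<xi>)) x / a \<le>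
      K * 4 powr s * 2 powr b / (1 - 2 powr (s - 2 * b)) * (1 - norm x) powr (s - b) / a"
      using assms ab by (intro divide_right_mono potential_exp_bound growth x) auto
    \<comment> \<open>\<open>s - b = a + (s - h)\<close>: the error is of higher order than the main
      term by the factor \<open>r powr a\<close>.\<close>
    also have "\<dots> = C * r powr a * r powr (s - h)"
      by (simp add: C_def nx a_def powr_add[symmetric])
    also have "\<dots> < c * 4 powr (- h) * r powr (s - h)"
      using elim by (intro mult_strict_right_mono) auto
    also have "\<dots> = (4 * r) powr (- h) * (c * r powr s)"
      using elim by (simp add: powr_mult powr_add[symmetric])
    finally show ?case using 1 2 by (simp add: x_def)
  qed
qed

lemma potential_critical_nonpos:
  assumes T: "closed T" "AE \<xi> in M. \<xi> \<in> T" and p: "p \<in> sphere 0 1" "p \<notin> T"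
  obtains \<eta> where "\<eta> > 0" "\<And>x. x \<in> ball 0 1 \<Longrightarrow> dist x p < \<eta> \<Longrightarrow> potential (critical_kernel h) x \<le> 0"
proof -
  obtain \<delta> where \<delta>: "\<delta> > 0" "ball p \<delta> \<subseteq> - T"
    using T(1) p(2) by (metis ComplI open_Compl open_contains_ball)
  \<comment> \<open>The first bound keeps \<open>x\<close> at distance at least
    \<open>\<delta>/2\<close> from \<open>T\<close>; the second gives
    \<open>1 - |x|^2 \<le> 2 \<eta> \<le> (\<delta>/2)^2\<close>. Together they force
    \<open>P \<le> 1\<close> on \<open>T\<close>.\<close>
  define \<eta> where "\<eta> = min (\<delta> / 2) (\<delta>\<^sup>2 / 8)"
  have "\<eta> > 0" using \<delta> by (simp add: \<eta>_def)
  moreover have "potential (critical_kernel h) x \<le> 0" if x: "x \<in> ball 0 1" and xp: "dist x p < \<eta>" for x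
  proof -
    have "AE \<xi> in M. critical_kernel h x \<xi> \<le> 0"
      using T(2) AE_space
    proof eventually_elim
      case (elim \<xi>)
      have \<xi>: "\<xi> \<in> sphere 0 1" using elim by (simp add: space_M)
      have "\<delta> \<le> dist p \<xi>" using \<delta> elim by (meson ComplD mem_ball not_less subsetD)
      then have far: "\<delta> / 2 \<le> norm (x - \<xi>)"
        using xp dist_triangle2[of p \<xi> x] by (simp add: \<eta>_def dist_norm norm_minus_commute)
      have "1 - norm x \<le> dist x p"
        using poisson_distance_bounds(1)[OF x p(1)] by (simp add: dist_norm)
      then have "(1 - norm x) * (1 + norm x) \<le> \<delta>\<^sup>2 / 8 * 2"
        using x xp by (intro mult_mono) (auto simp: \<eta>_def)
      also have "\<dots> = (\<delta> / 2)\<^sup>2" by (simp add: power2_eq_square)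
      also have "\<dots> \<le> (norm (x - \<xi>))\<^sup>2" using far \<delta> by (intro power_mono) auto
      finally have "1 - x \<bullet> x \<le> (x - \<xi>) \<bullet> (x - \<xi>)"
        by (simp add: dot_square_norm power2_eq_square algebra_simps)
      then have "log_poisson x \<xi> \<le> 0"
        unfolding log_poisson_def using poisson_factors_pos[OF x \<xi>] by simp
      then show ?case by (simp add: critical_kernel_def mult_nonpos_nonneg)
    qed
    then show ?thesis unfolding potential_def
      using integral_nonneg_AE[of "\<lambda>\<xi>. - critical_kernel h x \<xi>" M] by simp
  qed
  ultimately show ?thesis by (rule that)
qed

end

section \<open>The measure carried by \<Lambda> and the final assembly\<close>

lemma hausdorff_sphere_measure:
  fixes \<Lambda> :: "(real^'n::finite) set"
  assumes "s > 0" "\<Lambda> \<subseteq> sphere 0 1" "hausdorff_measure s \<Lambda> < \<infinity>"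
  obtains M where "sphere_measure M"
    "\<And>A. A \<in> sets borel \<Longrightarrow> emeasure M (A \<inter> sphere 0 1) = hausdorff_measure s (\<Lambda> \<inter> A)"
proof -
  obtain N :: "(real^'n) measure" where N: "sets N = sets borel"
    "\<And>A. A \<in> sets borel \<Longrightarrow> emeasure N A = hausdorff_measure s (\<Lambda> \<inter> A)"
    using hausdorff_measure_on_borel[OF \<open>s > 0\<close>, of \<Lambda>] by metis
  define M where "M = restrict_space N (sphere 0 1)"
  have "space N = UNIV" using sets_eq_imp_space_eq[OF N(1)] by simp
  have em: "emeasure M (A \<inter> sphere 0 1) = hausdorff_measure s (\<Lambda> \<inter> A)" if "A \<in> sets borel" for A
  proof -
    have "emeasure M (A \<inter> sphere 0 1) = emeasure N (A \<inter> sphere 0 1)"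
      unfolding M_def by (intro emeasure_restrict_space) (auto simp: N(1))
    also have "\<dots> = hausdorff_measure s (\<Lambda> \<inter> (A \<inter> sphere 0 1))"
      using that by (intro N(2)) auto
    also have "\<Lambda> \<inter> (A \<inter> sphere 0 1) = \<Lambda> \<inter> A" using assms(2) by auto
    finally show ?thesis .
  qed
  have "sphere_measure M"
  proof (intro sphere_measure.intro finite_measureI sphere_measure_axioms.intro)
    show "sets M = sets (restrict_space borel (sphere 0 1))"
      by (simp add: M_def sets_restrict_space N(1))
    have "space M = UNIV \<inter> sphere 0 1" by (simp add: M_def space_restrict_space \<open>space N = UNIV\<close>)
    then show "emeasure M (space M) \<noteq> \<infinity>" using em[of UNIV] assms(3) by simp
  qed
  then show ?thesis using em by (rule that)
qed

text \<open>\<open>M0\<close> is given by a formula in \<open>K\<close>, \<open>s\<close> and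
  \<open>h\<close>, so that the theorem can fix it before \<Lambda> is introduced.\<close>

lemma critical_potential_of_truly_dim:
  fixes \<Lambda> :: "(real^'n::finite) set" and s K :: real
  assumes h_def: "h = (real CARD('n) - 1) / 2"
    and h: "h > 0" "h < s" "s < 2 * h"
    and M0_def: "M0 = K * 4 powr s * 2 powr s / (1 - 2 powr (s - 2 * h))"
    and td: "truly_dim s K \<Lambda>"
  shows "\<exists>(u :: real^'n \<Rightarrow> real) \<Omega>.
       smooth_on (ball 0 1) u \<and>
       bounded (u ` ball 0 1) \<and>
       (\<forall>x\<in>ball 0 1. - hyp_laplacian u x = ((real CARD('n) - 1)\<^sup>2 / 4) * u x) \<and>
       open \<Omega> \<and> \<Omega> \<subseteq> ball 0 1 \<and>
       (\<forall>x\<in>\<Omega>. u x > 0) \<and>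
       (\<forall>x\<in>frontier \<Omega> \<inter> ball 0 1. u x = 0) \<and>
       closure \<Omega> \<inter> sphere 0 1 = closure \<Lambda> \<and>
       (\<forall>p\<in>\<Omega>. \<bar>u p\<bar> \<le> M0 * (hyp_dist p 0 + 1) *
                       exp (- (s - h) * hyp_dist p 0))"
proof -
  from td have \<Lambda>: "\<Lambda> \<subseteq> sphere 0 1" "hausdorff_measure s \<Lambda> < \<infinity>"
    and K: "K > 0" and lower: "\<And>p. p \<in> \<Lambda> \<Longrightarrow> Liminf (at_right 0) (\<lambda>r. hausdorff_measure s (\<Lambda> \<inter> ball p r) / ennreal (r powr s)) > 0"
    and upper: "\<And>p r. p \<in> \<Lambda> \<Longrightarrow> r > 0 \<Longrightarrow> hausdorff_measure s (\<Lambda> \<inter> ball p r) \<le> ennreal (K * r powr s)"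
    unfolding truly_dim_def by auto
  have "s > 0" using h by simp
  have M0: "M0 > 0" using K h powr_less_one[of 2 "s - 2 * h"] by (simp add: M0_def)
  interpret H: metric_outer_measure "hausdorff_measure s :: (real^'n) set \<Rightarrow> ennreal"
    by (rule metric_outer_measure_hausdorff[OF \<open>s > 0\<close>])
  obtain M where M: "sphere_measure M"
    and em: "\<And>A. A \<in> sets borel \<Longrightarrow> emeasure M (A \<inter> sphere 0 1) = hausdorff_measure s (\<Lambda> \<inter> A)"
    using hausdorff_sphere_measure[OF \<open>s > 0\<close> \<Lambda>] by metis
  interpret sphere_measure M by (rule M)
  \<comment> \<open>The given bound is for centres on \<Lambda>; a ball centred elsewhere either
    misses \<Lambda> or is moved to a point of \<Lambda> inside it at the cost of doubling the
    radius.\<close>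
  have growth: "emeasure M (ball x r \<inter> sphere 0 1) \<le> ennreal (K * (2 * r) powr s)" if "r > 0" for x r
  proof (cases "\<Lambda> \<inter> ball x r = {}")
    case True
    then show ?thesis using em[of "ball x r"] by (simp add: H.empty)
  next
    case False
    then obtain p where p: "p \<in> \<Lambda>" "p \<in> ball x r" by auto
    have "\<Lambda> \<inter> ball x r \<subseteq> \<Lambda> \<inter> ball p (2 * r)"
      using p(2) dist_triangle_less_add[of p x r _ r] by (auto simp: dist_commute)
    from H.mono[OF this] upper[OF p(1), of "2 * r"] that show ?thesis
      using em[of "ball x r"] by (auto intro: order_trans)
  qed
  define u where "u = potential (critical_kernel h)"
  define \<Omega> where "\<Omega> = {x \<in> ball 0 1. u x > 0}"
  have smooth: "smooth_on (ball 0 1) u"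
    unfolding u_def by (rule smooth_on_potential[OF kern_critical(1)])
  then have "iter_partial [] u differentiable_on ball 0 1" unfolding smooth_on_def by (rule spec)
  then have cont: "continuous_on (ball 0 1) u" by (simp add: differentiable_imp_continuous_on)
  have bound: "\<bar>u x\<bar> \<le> M0 * (hyp_dist x 0 + 1) * exp (- (s - h) * hyp_dist x 0)" if "x \<in> ball 0 1" for x
    unfolding u_def M0_def by (rule potential_critical_bound[OF growth K h that])
  have bdd: "bounded (u ` ball 0 1)"
    unfolding bounded_iff
  \<comment> \<open>The decay bound is bounded in \<open>d\<close>:
    \<open>d exp (- (s - h) d)\<close> is at most \<open>1 / (s - h)\<close> because
    \<open>(s - h) d \<le> exp ((s - h) d)\<close>, and the remaining exponential is at most
    1.\<close>
  proof (intro exI[of _ "M0 * (1 / (s - h) + 1)"] ballI, safe)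
    fix x :: "real^'n" assume x: "x \<in> ball 0 1"
    define d where "d = hyp_dist x 0"
    have d: "d \<ge> 0"
      unfolding d_def hyp_dist_0[OF x] using x norm_ge_zero[of x] by (simp add: ln_mono)
    have "(d + 1) * exp (- (s - h) * d) \<le> 1 / (s - h) + 1"
    proof -
      define E where "E = exp ((s - h) * d)"
      have "E > 0" "(s - h) * d \<le> E"
        using exp_ge_add_one_self[of "(s - h) * d"] unfolding E_def by (simp, linarith)
      then have "d * (1 / E) \<le> 1 / (s - h)"
        using h by (simp add: field_simps)
      moreover have "exp (- (s - h) * d) = 1 / E"
        by (simp add: E_def exp_minus[symmetric] divide_inverse algebra_simps)
      ultimately have "d * exp (- (s - h) * d) \<le> 1 / (s - h)" by (simp only:)
      moreover have "exp (- (s - h) * d) \<le> 1" using h d by (simp add: mult_nonpos_nonneg)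
      ultimately show ?thesis unfolding distrib_right mult_1_left by linarith
    qed
    then have "M0 * ((d + 1) * exp (- (s - h) * d)) \<le> M0 * (1 / (s - h) + 1)"
      using M0 by (intro mult_left_mono) auto
    then show "norm (u x) \<le> M0 * (1 / (s - h) + 1)"
      using bound[OF x] by (simp add: d_def mult.assoc)
  qed
  have eigen: "\<forall>x\<in>ball 0 1. - hyp_laplacian u x = ((real CARD('n) - 1)\<^sup>2 / 4) * u x"
    unfolding u_def
  proof
    fix x :: "real^'n" assume "x \<in> ball 0 1"
    from hyp_laplacian_potential_critical[OF this h_def]
    show "- hyp_laplacian (potential (critical_kernel h)) x =
        ((real CARD('n) - 1)\<^sup>2 / 4) * potential (critical_kernel h) x"
      by (simp only:) (simp add: h_def power_divide)
  qed
  have op: "open \<Omega>"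
    unfolding \<Omega>_def using continuous_open_preimage[OF cont open_ball, of "{0<..}"]
    by (simp add: vimage_def Int_def)
  have front: "u x = 0" if "x \<in> frontier \<Omega> \<inter> ball 0 1" for x
  proof (rule ccontr)
    assume "u x \<noteq> 0"
    have x: "x \<in> ball 0 1" "x \<in> closure \<Omega>" "x \<notin> \<Omega>"
      using that op by (auto simp: frontier_def interior_open)
    with \<open>u x \<noteq> 0\<close> have "u x < 0" by (auto simp: \<Omega>_def)
    \<comment> \<open>The set where \<open>u < 0\<close> is open and disjoint from \<Omega>, hence
      also disjoint from the closure of \<Omega>.\<close>
    have "open (ball 0 1 \<inter> u -` {..<0})"
      by (rule continuous_open_preimage[OF cont open_ball]) auto
    moreover have "ball 0 1 \<inter> u -` {..<0} \<inter> \<Omega> = {}" by (auto simp: \<Omega>_def)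
    ultimately have "ball 0 1 \<inter> u -` {..<0} \<inter> closure \<Omega> = {}"
      by (simp only: open_Int_closure_eq_empty)
    then show False using x \<open>u x < 0\<close> by blast
  qed
  have null: "AE \<xi> in M. \<xi> \<in> closure \<Lambda>"
  proof (rule AE_I[of _ _ "- closure \<Lambda> \<inter> sphere 0 1"])
    have "emeasure M (- closure \<Lambda> \<inter> sphere 0 1) = hausdorff_measure s (\<Lambda> \<inter> - closure \<Lambda>)"
      by (rule em) auto
    also have "\<Lambda> \<inter> - closure \<Lambda> = {}" using closure_subset by auto
    finally show "emeasure M (- closure \<Lambda> \<inter> sphere 0 1) = 0" by (simp add: H.empty)
    show "- closure \<Lambda> \<inter> sphere 0 1 \<in> sets M"
      unfolding sets_M sets_restrict_space by (rule image_eqI[of _ _ "- closure \<Lambda>"]) auto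
  qed (auto simp: space_M)
  have "p \<in> closure \<Omega>" if p: "p \<in> \<Lambda>" for p
  proof -
    \<comment> \<open>The lower density may be infinite; a value strictly below it is finite and
      serves as a real constant.\<close>
    obtain c' where c': "0 < c'" "c' < Liminf (at_right 0) (\<lambda>r. hausdorff_measure s (\<Lambda> \<inter> ball p r) / ennreal (r powr s))"
      using dense[OF lower[OF p]] by blast
    have "c' < top" using less_le_trans[OF c'(2) top_greatest] .
    then obtain c where c: "c' = ennreal c" "c > 0" using c'(1) by (cases c') auto
    have "\<forall>\<^sub>F r in at_right 0. ennreal (c * r powr s) \<le> emeasure M (ball p r \<inter> sphere 0 1)"
      using less_LiminfD[OF c'(2)] eventually_at_right_less[of 0]
    proof eventually_elim
      case (elim r)
      have "ennreal c * ennreal (r powr s) \<le>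
          hausdorff_measure s (\<Lambda> \<inter> ball p r) / ennreal (r powr s) * ennreal (r powr s)"
        using elim c by (intro mult_right_mono) auto
      also have "\<dots> = hausdorff_measure s (\<Lambda> \<inter> ball p r)"
        using elim by (subst ennreal_divide_times, subst ennreal_divide_self) auto
      also have "\<dots> = emeasure M (ball p r \<inter> sphere 0 1)" by (rule em[symmetric]) auto
      finally show ?case using c by (subst ennreal_mult) auto
    qed
    then have "\<forall>\<^sub>F r in at_right 0. u ((1 - r) *\<^sub>R p) > 0"
      unfolding u_def using p \<Lambda>(1) c(2) by (intro potential_critical_pos[OF growth K h]) auto
    moreover have "\<forall>\<^sub>F r in at_right (0::real). r \<in> {0<..<1}"
      by (rule eventually_at_rightI[of _ 1]) auto
    ultimately have in_\<Omega>: "\<forall>\<^sub>F r in at_right 0. (1 - r) *\<^sub>R p \<in> \<Omega>"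
    proof eventually_elim
      case (elim r)
      have "norm p = 1" using p \<Lambda>(1) by auto
      then show ?case using elim by (simp add: \<Omega>_def)
    qed
    have "((\<lambda>r. (1 - r) *\<^sub>R p) \<longlongrightarrow> (1 - 0) *\<^sub>R p) (at_right 0)"
      by (intro tendsto_intros)
    moreover have "\<forall>\<^sub>F r in at_right 0. (1 - r) *\<^sub>R p \<in> closure \<Omega>"
      using in_\<Omega> by eventually_elim (use closure_subset in blast)
    ultimately have "(1 - 0) *\<^sub>R p \<in> closure \<Omega>"
      by (intro Lim_in_closed_set[where S="closure \<Omega>" and F="at_right 0"]) auto
    then show ?thesis by simp
  qed
  then have "closure \<Lambda> \<subseteq> closure \<Omega>" by (intro closure_minimal) auto
  moreover have "closure \<Lambda> \<subseteq> sphere 0 1" using \<Lambda>(1) by (intro closure_minimal) auto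
  moreover have "p \<in> closure \<Lambda>" if p: "p \<in> closure \<Omega>" "p \<in> sphere 0 1" for p
  proof (rule ccontr)
    assume "p \<notin> closure \<Lambda>"
    from potential_critical_nonpos[OF closed_closure null p(2) this, of h]
    obtain \<eta> where \<eta>: "\<eta> > 0" "\<And>x. x \<in> ball 0 1 \<Longrightarrow> dist x p < \<eta> \<Longrightarrow> u x \<le> 0"
      unfolding u_def by metis
    obtain y where "y \<in> \<Omega>" "dist y p < \<eta>"
      using p(1) \<eta>(1) by (auto simp: closure_approachable)
    then show False using \<eta>(2)[of y] by (auto simp: \<Omega>_def)
  qed
  ultimately have clos: "closure \<Omega> \<inter> sphere 0 1 = closure \<Lambda>" by blast
  show ?thesis
  proof (intro exI conjI)
    show "smooth_on (ball 0 1) u" "bounded (u ` ball 0 1)" "open \<Omega>"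
      "closure \<Omega> \<inter> sphere 0 1 = closure \<Lambda>" by fact+
    show "\<forall>x\<in>ball 0 1. - hyp_laplacian u x = ((real CARD('n) - 1)\<^sup>2 / 4) * u x" by fact
    show "\<Omega> \<subseteq> ball 0 1" "\<forall>x\<in>\<Omega>. u x > 0" unfolding \<Omega>_def by blast+
    then show "\<forall>p\<in>\<Omega>. \<bar>u p\<bar> \<le> M0 * (hyp_dist p 0 + 1) * exp (- (s - h) * hyp_dist p 0)"
      using bound by blast
    show "\<forall>x\<in>frontier \<Omega> \<inter> ball 0 1. u x = 0" using front by blast
  qed
qed

theorem mainTheorem10:
  fixes s :: real
  assumes "CARD('n::finite) \<ge> 2"
    and "(real CARD('n) - 1) / 2 < s" and "s < real CARD('n) - 1"
  shows "\<forall>K>0. \<exists>M0>0. \<forall>\<Lambda> :: (real^'n) set. truly_dim s K \<Lambda> \<longrightarrow>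
    (\<exists>(u :: real^'n \<Rightarrow> real) \<Omega>.
       smooth_on (ball 0 1) u \<and>
       bounded (u ` ball 0 1) \<and>
       (\<forall>x\<in>ball 0 1. - hyp_laplacian u x = ((real CARD('n) - 1)\<^sup>2 / 4) * u x) \<and>
       open \<Omega> \<and> \<Omega> \<subseteq> ball 0 1 \<and>
       (\<forall>x\<in>\<Omega>. u x > 0) \<and>
       (\<forall>x\<in>frontier \<Omega> \<inter> ball 0 1. u x = 0) \<and>
       closure \<Omega> \<inter> sphere 0 1 = closure \<Lambda> \<and>
       (\<forall>p\<in>\<Omega>. \<bar>u p\<bar> \<le> M0 * (hyp_dist p 0 + 1) *
                       exp (- (s - (real CARD('n) - 1) / 2) * hyp_dist p 0)))"
proof (rule allI, rule impI, goal_cases)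
  case K: (1 K)
  define h where "h = (real CARD('n) - 1) / 2"
  have h: "h > 0" "h < s" "s < 2 * h" using assms by (auto simp: h_def)
  define M0 where "M0 = K * 4 powr s * 2 powr s / (1 - 2 powr (s - 2 * h))"
  have "M0 > 0" using K h powr_less_one[of 2 "s - 2 * h"] by (simp add: M0_def)
  then show ?case
    by (intro exI[of _ M0] conjI allI impI) (assumption, rule critical_potential_of_truly_dim[OF h_def h M0_def, unfolded h_def])
qed

end
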